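(* Let $(M^8,g,\rho)$ be a $\mathrm{PSU}(3)$-structure of type $\mathcal{W}_1\oplus\dots\oplus\mathcal{W}_5$ with parallel characteristic torsion and $\mathfrak{hol}(\nabla^c)=\mathfrak{psu}(3)$. Then $(M^8,g,\rho)$ is integrable, i.e. $\Gamma=0$.
   Context: Algebraic setting. $\mathbb{R}^8$ is oriented Euclidean space, identified with its dual; $(e_1,\dots,e_8)$ is an oriented orthonormal basis, $e_{i_1\dots i_j}=e_{i_1}\wedge\dots\wedge e_{i_j}$, $\Lambda^k$ the space of $k$-forms. For $\alpha\in\Lambda^k,\beta\in\Lambda^l$ put $\sigma_0(\alpha,\beta)=\alpha\wedge\beta$ and $\sigma_j(\alpha,\beta)=\sum_{i_1<\dots<i_j}(e_{i_1}\lrcorner\cdots\lrcorner e_{i_j}\lrcorner\alpha)\wedge(e_{i_1}\lrcorner\cdots\lrcorner e_{i_j}\lrcorner\beta)$. For $k\le l$ the contraction is $\alpha\lrcorner\beta=\sigma_k(\alpha,\beta)$; $\ast$ is the Hodge operator. Let $$(\star)\quad\rho=e_{246}-e_{235}-e_{145}-e_{136}+(e_{12}+e_{34}-2e_{56})\wedge e_7+\sqrt3\,(e_{12}-e_{34})\wedge e_8 ,$$ $\mathrm{PSU}(3)\subset\mathrm{SO}(8)$ its isotropy group, $\sigma_+(\alpha)=\sigma_1(\rho,\alpha)$. Modules: $\Lambda^2_8=\sigma_+(\Lambda^1)$, $\Lambda^2_{20}=\{\omega\in\Lambda^2\mid\omega\wedge\ast\rho=0\}$, $\Lambda^3_8=\{\ast(\omega\wedge\rho)\mid\omega\in\Lambda^2_8\}$,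 $\Lambda^3_{20}=\sigma_+(\Lambda^2_{20})$, $\Lambda^3_{27}=\{T\in\Lambda^3\mid T\wedge\rho=0,\ T\wedge\ast\rho=0\}$, $\Lambda^4_8=\sigma_+(\Lambda^3_8)$, $\Lambda^4_{27}=\sigma_+(\Lambda^3_{27})$. With $\mathfrak{so}(8)=\Lambda^2$ one has $\mathfrak{psu}(3)=\Lambda^2_8$; let $\mathfrak m=\Lambda^2_{20}$ be its orthogonal complement and $\mathrm{pr}_{\mathfrak m}$ the projection. Maps: $\Phi_1(X\otimes\omega)=X\wedge\omega$ and $\Phi_2(X\otimes\omega)=(X\lrcorner\rho)\wedge\omega$ on $\mathbb{R}^8\otimes\mathfrak m$; $\Theta_1(T)=-\frac12\sum_i e_i\otimes\mathrm{pr}_{\mathfrak m}(e_i\lrcorner T)$ for $T\in\Lambda^3$; $\Theta_2(F)=-\sum_i e_i\otimes\mathrm{pr}_{\mathfrak m}((e_i\lrcorner\rho)\lrcorner F)$ for $F\in\Lambda^4$. Put $\mathcal{W}_1=\Theta_1(\Lambda^3_8)$, $\mathcal{W}_2=\Theta_1(\Lambda^3_{20})$, $\mathcal{W}_3=\Theta_1(\Lambda^3_{27})$, $\mathcal{W}_4=\Theta_2(\ast\Lambda^4_8)$, $\mathcal{W}_5=\Theta_2(\ast\Lambda^4_{27})$, $\mathcal{W}_6=\mathrm{Ker}(\Phi_1)\cap\mathrm{Ker}(\Phi_2)$; then $\mathbb{R}^8\otimes\mathfrak m=\mathcal{W}_1\oplus\dots\oplus\mathcal{W}_6$. Geometric setting.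 A $\mathrm{PSU}(3)$-structure $(M^8,g,\rho)$ is an (oriented) Riemannian 8-manifold with a 3-form $\rho$ such that at every point there is an oriented orthonormal frame (an adapted frame) realizing $(\star)$; the operators $\sigma_j,\sigma_+,\ast$, the modules $\Lambda^k_i$ and $\mathfrak m$, the maps $\Phi_1,\Phi_2,\Theta_1,\Theta_2$ and the spaces $\mathcal{W}_1,\dots,\mathcal{W}_6$ are applied pointwise in adapted frames. Let $\Omega^g=(\omega^g_{ij})$, $\omega^g_{ij}=g(\nabla^g e_i,e_j)$, in an adapted frame. The intrinsic torsion is $\Gamma=\mathrm{pr}_{\mathfrak m}(\Omega^g)=\Gamma_1+\dots+\Gamma_6$, $\Gamma_i\in\mathcal{W}_i$. The structure is of type $\mathcal{W}_{i_1}\oplus\dots\oplus\mathcal{W}_{i_j}$ if $\Gamma\in\mathcal{W}_{i_1}\oplus\dots\oplus\mathcal{W}_{i_j}$. The characteristic forms are $T^c\in\Lambda^3_8\oplus\Lambda^3_{20}\oplus\Lambda^3_{27}$ with $\Theta_1(T^c)=\Gamma_1+\Gamma_2+\Gamma_3$ and $F^c\in\ast\Lambda^4_8\oplus\ast\Lambda^4_{27}$ with $\Theta_2(F^c)=\Gamma_4+\Gamma_5$. For a structure of type $\mathcal{W}_1\oplus\dots\oplus\mathcal{W}_5$ the characteristic connection $\nabla^c$ is the metric connection $g(\nabla^c_XY,Z)=g(\nabla^g_XY,Z)+\frac12T^c(X,Y,Z)+((X\lrcorner\rho)\lrcorner F^c)(Y,Z)$ (it satisfies $\nabla^c\rho=0$),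 with torsion $\mathcal{T}^c(X,Y,Z)=g(\nabla^c_XY-\nabla^c_YX-[X,Y],Z)$. Parallel characteristic torsion means $\nabla^c\mathcal{T}^c=0$ (equivalently $\nabla^cT^c=0$ and $\nabla^cF^c=0$). $\mathfrak{hol}(\nabla^c)$ is the holonomy algebra of $\nabla^c$; in an adapted frame it is a subalgebra of $\mathfrak{psu}(3)$, defined up to the adjoint action of $\mathrm{PSU}(3)$. *)

theory Defs
  imports "HOL-Analysis.Analysis"
begin

section \<open>Exterior algebra of Euclidean 8-space\<close>

text \<open>
  A (possibly inhomogeneous) form is given by its coefficients with respect to the basis
  of the increasing wedge products, one for each subset of the index type \<^typ>\<open>8\<close>.
  The elements of \<^typ>\<open>8\<close> are \<open>0 < 1 < \<dots> < 7\<close>, so the basis vector written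
  \<open>e\<^sub>i\<close> on paper, with \<open>1 \<le> i \<le> 8\<close>, has index \<open>i - 1\<close>. The standard inner product of
  \<^typ>\<open>real^(8 set)\<close> is the one in which the increasing wedge products are orthonormal.
\<close>

type_synonym form = "real^(8 set)"

definition wedge_sign :: "8 set \<Rightarrow> 8 set \<Rightarrow> real" where
  "wedge_sign J K = (- 1) ^ card {(j, k). j \<in> J \<and> k \<in> K \<and> k < j}"

definition wedge :: "form \<Rightarrow> form \<Rightarrow> form" (infixl "\<and>\<^sub>w" 70) where
  "\<alpha> \<and>\<^sub>w \<beta> = (\<chi> I. \<Sum>J\<in>Pow I. wedge_sign J (I - J) * \<alpha> $ J * \<beta> $ (I - J))"

text \<open>Hodge operator, normalised by \<open>e\<^sub>I \<and> \<ast>e\<^sub>I = e\<^bsub>1\<dots>8\<^esub>\<close>.\<close>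

definition hodge :: "form \<Rightarrow> form" where
  "hodge \<alpha> = (\<chi> I. wedge_sign (- I) I * \<alpha> $ (- I))"

text \<open>Interior product with a basis vector.\<close>

definition contract :: "8 \<Rightarrow> form \<Rightarrow> form" where
  "contract i \<alpha> = (\<chi> I. if i \<in> I then 0 else (- 1) ^ card {j \<in> I. j < i} * \<alpha> $ (insert i I))"

text \<open>For \<open>I = {i\<^sub>1 < \<dots> < i\<^sub>j}\<close> this is \<open>e\<^bsub>i\<^sub>1\<^esub> \<lrcorner> \<cdots> \<lrcorner> e\<^bsub>i\<^sub>j\<^esub> \<lrcorner> \<alpha>\<close>, so \<open>e\<^bsub>i\<^sub>j\<^esub>\<close> is inserted first.\<close>

definition contract_set :: "8 set \<Rightarrow> form \<Rightarrow> form" where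
  "contract_set I \<alpha> = foldr contract (sorted_list_of_set I) \<alpha>"

definition sigma :: "nat \<Rightarrow> form \<Rightarrow> form \<Rightarrow> form" where
  "sigma j \<alpha> \<beta> = (\<Sum>I | card I = j. contract_set I \<alpha> \<and>\<^sub>w contract_set I \<beta>)"

definition Lam :: "nat \<Rightarrow> form set" where
  "Lam k = {\<alpha>. \<forall>I. card I \<noteq> k \<longrightarrow> \<alpha> $ I = 0}"

text \<open>\<open>ef [i\<^sub>1, \<dots>, i\<^sub>k]\<close> with \<open>1 \<le> i\<^sub>1 < \<dots> < i\<^sub>k \<le> 8\<close> is \<open>e\<^bsub>i\<^sub>1\<dots>i\<^sub>k\<^esub>\<close>, in one-based numbering.\<close>

definition ef :: "nat list \<Rightarrow> form" where
  "ef is = axis ((\<lambda>i. of_nat (i - 1)) ` set is) 1"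

definition rho0 :: form where
  "rho0 = ef [2,4,6] - ef [2,3,5] - ef [1,4,5] - ef [1,3,6]
          + (ef [1,2] + ef [3,4] - 2 *\<^sub>R ef [5,6]) \<and>\<^sub>w ef [7]
          + sqrt 3 *\<^sub>R ((ef [1,2] - ef [3,4]) \<and>\<^sub>w ef [8])"

definition sigma_plus :: "form \<Rightarrow> form" where
  "sigma_plus \<alpha> = sigma 1 rho0 \<alpha>"

definition Lam2_8 :: "form set" where
  "Lam2_8 = sigma_plus ` Lam 1"

definition Lam2_20 :: "form set" where
  "Lam2_20 = {\<omega> \<in> Lam 2. \<omega> \<and>\<^sub>w hodge rho0 = 0}"

definition Lam3_8 :: "form set" where
  "Lam3_8 = {hodge (\<omega> \<and>\<^sub>w rho0) | \<omega>. \<omega> \<in> Lam2_8}"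

definition Lam3_20 :: "form set" where
  "Lam3_20 = sigma_plus ` Lam2_20"

definition Lam3_27 :: "form set" where
  "Lam3_27 = {T \<in> Lam 3. T \<and>\<^sub>w rho0 = 0 \<and> T \<and>\<^sub>w hodge rho0 = 0}"

definition Lam4_8 :: "form set" where
  "Lam4_8 = sigma_plus ` Lam3_8"

definition Lam4_27 :: "form set" where
  "Lam4_27 = sigma_plus ` Lam3_27"

definition orth_proj :: "form set \<Rightarrow> form \<Rightarrow> form" where
  "orth_proj S \<omega> = (THE \<eta>. \<eta> \<in> S \<and> (\<forall>\<zeta>\<in>S. inner (\<omega> - \<eta>) \<zeta> = 0))"

definition pr_m :: "form \<Rightarrow> form" where
  "pr_m = orth_proj Lam2_20"


section \<open>The modules of intrinsic torsion\<close>

text \<open>\<open>\<real>\<^sup>8 \<otimes> \<Lambda>\<^sup>2\<close> is represented by \<^typ>\<open>form^8\<close>: \<open>G\<close> stands for \<open>\<Sum>\<^sub>i e\<^sub>i \<otimes> G $ i\<close>.\<close>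

definition R8_m :: "(form^8) set" where
  "R8_m = {G. \<forall>i. G $ i \<in> Lam2_20}"

definition Phi1 :: "form^8 \<Rightarrow> form" where
  "Phi1 G = (\<Sum>i\<in>UNIV. axis {i} 1 \<and>\<^sub>w G $ i)"

definition Phi2 :: "form^8 \<Rightarrow> form" where
  "Phi2 G = (\<Sum>i\<in>UNIV. contract i rho0 \<and>\<^sub>w G $ i)"

definition Theta1 :: "form \<Rightarrow> form^8" where
  "Theta1 T = (\<chi> i. - (1/2) *\<^sub>R pr_m (contract i T))"

definition Theta2 :: "form \<Rightarrow> form^8" where
  "Theta2 F = (\<chi> i. - pr_m (sigma 2 (contract i rho0) F))"

definition W :: "nat \<Rightarrow> (form^8) set" where
  "W j = (if j = 1 then Theta1 ` Lam3_8
     else if j = 2 then Theta1 ` Lam3_20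
     else if j = 3 then Theta1 ` Lam3_27
     else if j = 4 then Theta2 ` hodge ` Lam4_8
     else if j = 5 then Theta2 ` hodge ` Lam4_27
     else {G \<in> R8_m. Phi1 G = 0 \<and> Phi2 G = 0})"

definition in_W_sum :: "nat set \<Rightarrow> form^8 \<Rightarrow> bool" where
  "in_W_sum J \<Gamma> \<longleftrightarrow> (\<exists>G. (\<forall>j\<in>J. G j \<in> W j) \<and> \<Gamma> = (\<Sum>j\<in>J. G j))"

text \<open>\<open>G 1, \<dots>, G 6\<close> are the components of \<open>\<Gamma>\<close> in \<open>W 1 \<oplus> \<dots> \<oplus> W 6\<close>.\<close>

definition W_components :: "form^8 \<Rightarrow> (nat \<Rightarrow> form^8) \<Rightarrow> bool" where
  "W_components \<Gamma> G \<longleftrightarrow> (\<forall>j\<in>{1..6}. G j \<in> W j) \<and> \<Gamma> = (\<Sum>j=1..6. G j)"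


section \<open>Covariant tensors in components\<close>

text \<open>
  \<^term>\<open>t :: 8 list \<Rightarrow> real\<close>, restricted to the lists of length \<open>k\<close>, is the component family of
  a covariant \<open>k\<close>-tensor; \<open>teval t [v\<^sub>1, \<dots>, v\<^sub>k]\<close> is its value on \<open>k\<close> vectors.
\<close>

definition teval :: "(8 list \<Rightarrow> real) \<Rightarrow> (real^8) list \<Rightarrow> real" where
  "teval t vs = (\<Sum>js | length js = length vs. t js * (\<Prod>r<length vs. (vs ! r) $ (js ! r)))"

text \<open>Components of a form: \<open>form_comp \<alpha> [i\<^sub>1, \<dots>, i\<^sub>k] = \<alpha>(e\<^bsub>i\<^sub>1\<^esub>, \<dots>, e\<^bsub>i\<^sub>k\<^esub>)\<close>.\<close>

definition form_comp :: "form \<Rightarrow> 8 list \<Rightarrow> real" where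
  "form_comp \<alpha> is = fold contract is \<alpha> $ {}"

text \<open>
  A frame is a matrix whose columns are the frame vectors. \<open>frame_form k t u\<close> is the
  alternating tensor \<open>t\<close>, expressed as a \<open>k\<close>-form in the frame \<open>u\<close>.
\<close>

definition frame_form :: "nat \<Rightarrow> (8 list \<Rightarrow> real) \<Rightarrow> real^8^8 \<Rightarrow> form" where
  "frame_form k t u =
     (\<chi> I. if card I = k then teval t (map (\<lambda>i. column i u) (sorted_list_of_set I)) else 0)"


section \<open>Matrix groups and their Lie algebras\<close>

text \<open>The Lie algebra of a matrix group: the initial velocities of its one-parameter subgroups.\<close>

definition lie_algebra :: "(real^8^8) set \<Rightarrow> (real^8^8) set" where
  "lie_algebra H = {B. \<exists>h :: real \<Rightarrow> real^8^8.
     (\<forall>s t. h (s + t) = h s ** h t) \<and> h 0 = mat 1 \<and>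
     (h has_vector_derivative B) (at 0) \<and> (\<forall>t. h t \<in> H)}"

definition PSU3 :: "(real^8^8) set" where
  "PSU3 = {h. orthogonal_matrix h \<and> det h = 1 \<and> frame_form 3 (form_comp rho0) h = rho0}"

definition psu3 :: "(real^8^8) set" where
  "psu3 = lie_algebra PSU3"


section \<open>Oriented smooth 8-manifolds and tensor fields\<close>

primrec Ck_on :: "nat \<Rightarrow> (real^8) set \<Rightarrow> (real^8 \<Rightarrow> 'b::real_normed_vector) \<Rightarrow> bool" where
  "Ck_on 0 S f \<longleftrightarrow> continuous_on S f"
| "Ck_on (Suc k) S f \<longleftrightarrow> (\<forall>x\<in>S. f differentiable (at x)) \<and>
     (\<forall>v. Ck_on k S (\<lambda>x. frechet_derivative f (at x) v))"

text \<open>All iterated partial derivatives exist and are continuous; meaningful for open \<open>S\<close>.\<close>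

definition smooth_on :: "(real^8) set \<Rightarrow> (real^8 \<Rightarrow> 'b::real_normed_vector) \<Rightarrow> bool" where
  "smooth_on S f \<longleftrightarrow> (\<forall>k. Ck_on k S f)"

type_synonym 'a chart = "'a set \<times> ('a \<Rightarrow> real^8)"

definition chart_dom :: "'a chart \<Rightarrow> 'a set" where
  "chart_dom c = fst c"

definition chart_map :: "'a chart \<Rightarrow> 'a \<Rightarrow> real^8" where
  "chart_map c = snd c"

definition chart_img :: "'a chart \<Rightarrow> (real^8) set" where
  "chart_img c = chart_map c ` chart_dom c"

definition transition :: "'a chart \<Rightarrow> 'a chart \<Rightarrow> real^8 \<Rightarrow> real^8" where
  "transition c d = chart_map d \<circ> inv_into (chart_dom c) (chart_map c)"

definition overlap :: "'a chart \<Rightarrow> 'a chart \<Rightarrow> (real^8) set" where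
  "overlap c d = chart_map c ` (chart_dom c \<inter> chart_dom d)"

definition transition_jac :: "'a chart \<Rightarrow> 'a chart \<Rightarrow> real^8 \<Rightarrow> real^8^8" where
  "transition_jac c d x = jacobian (transition c d) (at x)"

definition oriented_atlas :: "'a::{t2_space,second_countable_topology} chart set \<Rightarrow> bool" where
  "oriented_atlas A \<longleftrightarrow>
     (\<forall>c\<in>A. open (chart_dom c) \<and> open (chart_img c) \<and>
        homeomorphism (chart_dom c) (chart_img c) (chart_map c)
          (inv_into (chart_dom c) (chart_map c))) \<and>
     (\<Union>c\<in>A. chart_dom c) = UNIV \<and>
     (\<forall>c\<in>A. \<forall>d\<in>A. smooth_on (overlap c d) (transition c d) \<and>
        (\<forall>x\<in>overlap c d. det (transition_jac c d x) > 0))"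

text \<open>
  A covariant tensor field assigns to a chart \<open>c\<close> and a coordinate point \<open>x\<close> in
  \<^term>\<open>chart_img c\<close> its components with respect to the coordinate vector fields.
\<close>

type_synonym 'a tensor = "'a chart \<Rightarrow> real^8 \<Rightarrow> 8 list \<Rightarrow> real"

definition tensor_field :: "'a chart set \<Rightarrow> nat \<Rightarrow> 'a tensor \<Rightarrow> bool" where
  "tensor_field A k \<tau> \<longleftrightarrow>
     (\<forall>c\<in>A. \<forall>is. length is = k \<longrightarrow> smooth_on (chart_img c) (\<lambda>x. \<tau> c x is)) \<and>
     (\<forall>c\<in>A. \<forall>d\<in>A. \<forall>x\<in>overlap c d. \<forall>is. length is = k \<longrightarrow>
        \<tau> c x is = teval (\<tau> d (transition c d x)) (map (\<lambda>i. column i (transition_jac c d x)) is))"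

definition differential_form :: "'a chart set \<Rightarrow> nat \<Rightarrow> 'a tensor \<Rightarrow> bool" where
  "differential_form A k \<tau> \<longleftrightarrow> tensor_field A k \<tau> \<and>
     (\<forall>c\<in>A. \<forall>x\<in>chart_img c. \<forall>is r s. length is = k \<and> r < s \<and> s < k \<longrightarrow>
        \<tau> c x (is[r := is ! s, s := is ! r]) = - \<tau> c x is)"

definition riemannian_metric :: "'a chart set \<Rightarrow> 'a tensor \<Rightarrow> bool" where
  "riemannian_metric A g \<longleftrightarrow> tensor_field A 2 g \<and>
     (\<forall>c\<in>A. \<forall>x\<in>chart_img c. (\<forall>i j. g c x [i, j] = g c x [j, i]) \<and>
        (\<forall>v. v \<noteq> 0 \<longrightarrow> teval (g c x) [v, v] > 0))"


section \<open>Connections\<close>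

text \<open>
  A linear connection is given by its coefficient vectors: in the chart \<open>c\<close> at \<open>x\<close>, the vector
  \<open>C c x m i\<close> is the covariant derivative of \<open>\<partial>\<^sub>i\<close> in the direction \<open>\<partial>\<^sub>m\<close>.
\<close>

type_synonym 'a connection = "'a chart \<Rightarrow> real^8 \<Rightarrow> 8 \<Rightarrow> 8 \<Rightarrow> real^8"

definition partial :: "8 \<Rightarrow> (real^8 \<Rightarrow> real) \<Rightarrow> real^8 \<Rightarrow> real" where
  "partial m f x = frechet_derivative f (at x) (axis m 1)"

text \<open>The Levi-Civita connection, by its Christoffel symbols.\<close>

definition levi_civita :: "'a tensor \<Rightarrow> 'a connection" where
  "levi_civita g c x m i = (\<chi> l. 1/2 * (\<Sum>s\<in>UNIV. matrix_inv (\<chi> a b. g c x [a, b]) $ l $ s *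
     (partial m (\<lambda>y. g c y [s, i]) x + partial i (\<lambda>y. g c y [s, m]) x
       - partial s (\<lambda>y. g c y [m, i]) x)))"

text \<open>The zeroth-order term \<open>\<Sum>\<^sub>m\<^sub>,\<^sub>i X\<^sup>m Y\<^sup>i C\<^sub>m\<^sub>i\<close> of the covariant derivative of \<open>Y\<close> along \<open>X\<close>.\<close>

definition conn_term :: "'a connection \<Rightarrow> 'a chart \<Rightarrow> real^8 \<Rightarrow> real^8 \<Rightarrow> real^8 \<Rightarrow> real^8" where
  "conn_term C c x X Y = (\<Sum>m\<in>UNIV. \<Sum>i\<in>UNIV. (X $ m * Y $ i) *\<^sub>R C c x m i)"

definition cov_deriv ::
    "'a connection \<Rightarrow> 'a chart \<Rightarrow> real^8 \<Rightarrow> real^8 \<Rightarrow> (real^8 \<Rightarrow> real^8) \<Rightarrow> real^8" where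
  "cov_deriv C c x X Y = frechet_derivative Y (at x) X + conn_term C c x X (Y x)"

definition cov_deriv_tensor ::
    "'a connection \<Rightarrow> 'a tensor \<Rightarrow> 'a chart \<Rightarrow> real^8 \<Rightarrow> 8 \<Rightarrow> 8 list \<Rightarrow> real" where
  "cov_deriv_tensor C \<tau> c x m is = partial m (\<lambda>y. \<tau> c y is) x
     - (\<Sum>r<length is. \<Sum>l\<in>UNIV. C c x m (is ! r) $ l * \<tau> c x (is[r := l]))"

definition parallel_tensor :: "'a chart set \<Rightarrow> 'a connection \<Rightarrow> nat \<Rightarrow> 'a tensor \<Rightarrow> bool" where
  "parallel_tensor A C k \<tau> \<longleftrightarrow>
     (\<forall>c\<in>A. \<forall>x\<in>chart_img c. \<forall>is. length is = k \<longrightarrow>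
        (\<lambda>y. \<tau> c y is) differentiable (at x) \<and> (\<forall>m. cov_deriv_tensor C \<tau> c x m is = 0))"

text \<open>
  \<open>torsion g C\<close> is the torsion of \<open>C\<close> with its last argument lowered by \<open>g\<close>; coordinate vector
  fields commute, so there is no bracket term.
\<close>

definition torsion :: "'a tensor \<Rightarrow> 'a connection \<Rightarrow> 'a tensor" where
  "torsion g C c x is = teval (g c x)
     [C c x (is ! 0) (is ! 1) - C c x (is ! 1) (is ! 0), axis (is ! 2) 1]"

definition C1_curve :: "'a::topological_space chart set \<Rightarrow> (real \<Rightarrow> 'a) \<Rightarrow> bool" where
  "C1_curve A \<gamma> \<longleftrightarrow> continuous_on UNIV \<gamma> \<and>
     (\<forall>c\<in>A. (chart_map c \<circ> \<gamma>) C1_differentiable_on (\<gamma> -` chart_dom c))"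

text \<open>
  \<open>V c t\<close> are the components in the chart \<open>c\<close> of a vector at \<open>\<gamma> t\<close>, for the \<open>t\<close> with
  \<open>\<gamma> t \<in> chart_dom c\<close>.
\<close>

definition parallel_along ::
    "'a chart set \<Rightarrow> 'a connection \<Rightarrow> (real \<Rightarrow> 'a) \<Rightarrow> ('a chart \<Rightarrow> real \<Rightarrow> real^8) \<Rightarrow> bool" where
  "parallel_along A C \<gamma> V \<longleftrightarrow>
     (\<forall>c\<in>A. \<forall>t. \<gamma> t \<in> chart_dom c \<longrightarrow>
        (V c has_vector_derivative
           - conn_term C c (chart_map c (\<gamma> t)) (vector_derivative (chart_map c \<circ> \<gamma>) (at t)) (V c t)) (at t) \<and>
        (\<forall>d\<in>A. \<gamma> t \<in> chart_dom d \<longrightarrow>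
           V d t = transition_jac c d (chart_map c (\<gamma> t)) *v V c t))"

text \<open>
  Holonomy group at \<open>p\<close>, as a matrix group via the coordinate basis of the chart \<open>c\<close>. Parallel
  transport does not depend on the parametrisation, and a piecewise \<open>C\<^sup>1\<close> loop can be
  reparametrised so that it rests at its corners and at its ends and is then extended constantly;
  so the loops can be taken to be \<open>C\<^sup>1\<close> on the whole real line.
\<close>

definition holonomy_group ::
    "'a::topological_space chart set \<Rightarrow> 'a connection \<Rightarrow> 'a chart \<Rightarrow> 'a \<Rightarrow> (real^8^8) set" where
  "holonomy_group A C c p = {P. \<exists>\<gamma>. C1_curve A \<gamma> \<and> \<gamma> 0 = p \<and> \<gamma> 1 = p \<and>
     (\<forall>v. \<exists>V. parallel_along A C \<gamma> V \<and> V c 0 = v \<and> V c 1 = P *v v)}"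

text \<open>The holonomy algebra, expressed in the frame \<open>u\<close> of the tangent space at \<open>p\<close>.\<close>

definition holonomy_algebra ::
    "'a::topological_space chart set \<Rightarrow> 'a connection \<Rightarrow> 'a chart \<Rightarrow> 'a \<Rightarrow> real^8^8 \<Rightarrow> (real^8^8) set" where
  "holonomy_algebra A C c p u =
     (\<lambda>B. matrix_inv u ** B ** u) ` lie_algebra (holonomy_group A C c p)"


section \<open>PSU(3)-structures\<close>

text \<open>An oriented orthonormal frame at the point \<open>x\<close> of the chart \<open>c\<close> in which \<open>\<rho>\<close> is \<^term>\<open>rho0\<close>.\<close>

definition adapted_frame :: "'a tensor \<Rightarrow> 'a tensor \<Rightarrow> 'a chart \<Rightarrow> real^8 \<Rightarrow> real^8^8 \<Rightarrow> bool" where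
  "adapted_frame g \<rho> c x u \<longleftrightarrow>
     (\<forall>i j. teval (g c x) [column i u, column j u] = (if i = j then 1 else 0)) \<and>
     det u > 0 \<and> frame_form 3 (\<rho> c x) u = rho0"

definition psu3_structure ::
    "'a::{t2_space,second_countable_topology} chart set \<Rightarrow> 'a tensor \<Rightarrow> 'a tensor \<Rightarrow> bool" where
  "psu3_structure A g \<rho> \<longleftrightarrow> oriented_atlas A \<and> riemannian_metric A g \<and> differential_form A 3 \<rho> \<and>
     (\<forall>c\<in>A. \<forall>x\<in>chart_img c. \<exists>u. adapted_frame g \<rho> c x u)"

definition local_adapted_frame ::
    "'a chart set \<Rightarrow> 'a tensor \<Rightarrow> 'a tensor \<Rightarrow> 'a chart \<Rightarrow> (real^8) set \<Rightarrow> (real^8 \<Rightarrow> real^8^8) \<Rightarrow> bool" where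
  "local_adapted_frame A g \<rho> c U e \<longleftrightarrow> c \<in> A \<and> open U \<and> U \<subseteq> chart_img c \<and> smooth_on U e \<and>
     (\<forall>x\<in>U. adapted_frame g \<rho> c x (e x))"

text \<open>The connection form \<open>\<omega>\<^sub>i\<^sub>j(e\<^sub>k) = g(\<nabla>\<^bsub>e\<^sub>k\<^esub> e\<^sub>i, e\<^sub>j)\<close> of the frame field \<open>e\<close>.\<close>

definition conn_form ::
    "'a tensor \<Rightarrow> 'a connection \<Rightarrow> 'a chart \<Rightarrow> (real^8 \<Rightarrow> real^8^8) \<Rightarrow> real^8 \<Rightarrow> 8 \<Rightarrow> 8 \<Rightarrow> 8 \<Rightarrow> real" where
  "conn_form g C c e x k i j =
     teval (g c x) [cov_deriv C c x (column k (e x)) (\<lambda>y. column i (e y)), column j (e x)]"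

text \<open>The identification of a skew matrix \<open>(a\<^sub>i\<^sub>j)\<close> with the 2-form \<open>\<Sum>\<^sub>i\<^sub><\<^sub>j a\<^sub>i\<^sub>j e\<^sub>i\<^sub>j\<close>.\<close>

definition two_form :: "(8 \<Rightarrow> 8 \<Rightarrow> real) \<Rightarrow> form" where
  "two_form a = (\<chi> I. if card I = 2 then a (Min I) (Max I) else 0)"

definition intrinsic_torsion ::
    "'a tensor \<Rightarrow> 'a chart \<Rightarrow> (real^8 \<Rightarrow> real^8^8) \<Rightarrow> real^8 \<Rightarrow> form^8" where
  "intrinsic_torsion g c e x = (\<chi> k. pr_m (two_form (conn_form g (levi_civita g) c e x k)))"

text \<open>
  Conditions on the intrinsic torsion are imposed in all smooth local adapted frames; such
  frames exist around every point, because \<open>SO(8) \<rightarrow> SO(8)\<cdot>rho0\<close> has smooth local sections.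
\<close>

definition of_type :: "'a chart set \<Rightarrow> 'a tensor \<Rightarrow> 'a tensor \<Rightarrow> nat set \<Rightarrow> bool" where
  "of_type A g \<rho> J \<longleftrightarrow>
     (\<forall>c U e. local_adapted_frame A g \<rho> c U e \<longrightarrow>
        (\<forall>x\<in>U. in_W_sum J (intrinsic_torsion g c e x)))"

definition psu3_integrable :: "'a chart set \<Rightarrow> 'a tensor \<Rightarrow> 'a tensor \<Rightarrow> bool" where
  "psu3_integrable A g \<rho> \<longleftrightarrow>
     (\<forall>c U e. local_adapted_frame A g \<rho> c U e \<longrightarrow> (\<forall>x\<in>U. intrinsic_torsion g c e x = 0))"

text \<open>\<open>T\<close> and \<open>F\<close> are the characteristic forms; they are uniquely determined.\<close>

definition characteristic_forms ::
    "'a chart set \<Rightarrow> 'a tensor \<Rightarrow> 'a tensor \<Rightarrow> 'a tensor \<Rightarrow> 'a tensor \<Rightarrow> bool" where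
  "characteristic_forms A g \<rho> T F \<longleftrightarrow> differential_form A 3 T \<and> differential_form A 4 F \<and>
     (\<forall>c U e. local_adapted_frame A g \<rho> c U e \<longrightarrow> (\<forall>x\<in>U.
        frame_form 3 (T c x) (e x) \<in> {a + b + d | a b d. a \<in> Lam3_8 \<and> b \<in> Lam3_20 \<and> d \<in> Lam3_27} \<and>
        frame_form 4 (F c x) (e x) \<in> {hodge a + hodge b | a b. a \<in> Lam4_8 \<and> b \<in> Lam4_27} \<and>
        (\<exists>G. W_components (intrinsic_torsion g c e x) G \<and>
           Theta1 (frame_form 3 (T c x) (e x)) = G 1 + G 2 + G 3 \<and>
           Theta2 (frame_form 4 (F c x) (e x)) = G 4 + G 5)))"

text \<open>
  The connection \<open>g(\<nabla>\<^sup>c\<^sub>X Y, Z) = g(\<nabla>\<^sup>g\<^sub>X Y, Z) + 1/2 T(X, Y, Z) + ((X \<lrcorner> \<rho>) \<lrcorner> F)(Y, Z)\<close>, evaluated on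
  the vectors \<open>X, Y, Z\<close> of an adapted frame; this determines the coefficients.
\<close>

definition characteristic_connection ::
    "'a chart set \<Rightarrow> 'a tensor \<Rightarrow> 'a tensor \<Rightarrow> 'a tensor \<Rightarrow> 'a tensor \<Rightarrow> 'a connection \<Rightarrow> bool" where
  "characteristic_connection A g \<rho> T F C \<longleftrightarrow>
     (\<forall>c\<in>A. \<forall>x\<in>chart_img c. \<forall>u. adapted_frame g \<rho> c x u \<longrightarrow> (\<forall>k i j.
        teval (g c x) [conn_term C c x (column k u) (column i u), column j u] =
        teval (g c x) [conn_term (levi_civita g) c x (column k u) (column i u), column j u]
        + 1/2 * teval (T c x) [column k u, column i u, column j u]
        + form_comp (sigma 2 (contract k rho0) (frame_form 4 (F c x) u)) [i, j]))"

end

theory Submission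
  imports Defs
begin

text \<open>
  In an adapted frame \<open>u\<close> the torsion of \<open>\<nabla>\<^sup>c\<close> has the components \<open>D\<^sub>k\<^sub>i\<^sub>j - D\<^sub>i\<^sub>k\<^sub>j\<close>, where \<open>D\<^sub>k\<close> is
  the 2-form \<open>1/2 e\<^sub>k \<lrcorner> T + (e\<^sub>k \<lrcorner> \<rho>) \<lrcorner> F\<close>. Being parallel, the torsion is annihilated by the
  holonomy algebra \<open>psu(3)\<close>, and hence so is \<open>D\<close>, viewed as a linear map from \<open>\<real>\<^sup>8\<close> to \<open>\<Lambda>\<^sup>2\<close>.
  The Casimir operator acts on \<open>\<real>\<^sup>8\<close> and on \<open>m\<close> by different scalars, so \<open>D\<close> has values in
  \<open>psu(3)\<close>, which is the span of the \<open>e\<^sub>c \<lrcorner> \<rho>\<close>. Therefore \<open>pr\<^sub>m D\<^sub>k = 0\<close> for all \<open>k\<close>, that is,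
  \<open>\<Theta>\<^sub>1(T) + \<Theta>\<^sub>2(F) = 0\<close>. Finally, \<open>\<Theta>\<^sub>1\<close> and \<open>\<Theta>\<^sub>2\<close> are adjoint to \<open>\<Phi>\<^sub>1\<close> and \<open>\<Phi>\<^sub>2\<close> up to factors,
  so \<open>W\<^sub>6\<close> is orthogonal to the other modules and contributes nothing either.
\<close>

section \<open>Wedge products and contractions\<close>

lemma wedge_nth: "(\<alpha> \<and>\<^sub>w \<beta>) $ I = (\<Sum>J\<in>Pow I. wedge_sign J (I - J) * \<alpha> $ J * \<beta> $ (I - J))"
  by (simp add: wedge_def)

lemma wedge_add_left: "(\<alpha> + \<beta>) \<and>\<^sub>w \<gamma> = \<alpha> \<and>\<^sub>w \<gamma> + \<beta> \<and>\<^sub>w \<gamma>"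
  by (simp add: vec_eq_iff wedge_nth algebra_simps sum.distrib)

lemma wedge_scaleR_left: "(c *\<^sub>R \<alpha>) \<and>\<^sub>w \<beta> = c *\<^sub>R (\<alpha> \<and>\<^sub>w \<beta>)"
  by (simp add: vec_eq_iff wedge_nth sum_distrib_left algebra_simps)

lemma wedge_zero_left [simp]: "0 \<and>\<^sub>w \<beta> = 0"
  and wedge_zero_right [simp]: "\<beta> \<and>\<^sub>w 0 = 0"
  by (simp_all add: vec_eq_iff wedge_nth)

lemma wedge_minus_left: "(- \<alpha>) \<and>\<^sub>w \<beta> = - (\<alpha> \<and>\<^sub>w \<beta>)"
  using wedge_scaleR_left [of "-1"] by simp

lemma wedge_diff_left: "(\<alpha> - \<beta>) \<and>\<^sub>w \<gamma> = \<alpha> \<and>\<^sub>w \<gamma> - \<beta> \<and>\<^sub>w \<gamma>"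
  by (simp add: vec_eq_iff wedge_nth algebra_simps sum_subtractf)

lemma wedge_sum_left: "(\<Sum>x\<in>S. f x) \<and>\<^sub>w \<beta> = (\<Sum>x\<in>S. f x \<and>\<^sub>w \<beta>)"
  by (induction S rule: infinite_finite_induct) (simp_all add: wedge_add_left)

text \<open>\<open>wedge_sign\<close> counts inversions between two index blocks, and the inversions
  of a disjoint union split according to the block they come from. Associativity and the signs of
  contractions rest on this and its mirror image.\<close>

lemma wedge_sign_Un_left:
  assumes "J \<inter> K = {}"
  shows "wedge_sign (J \<union> K) L = wedge_sign J L * wedge_sign K L"
proof -
  have "{(j, k). j \<in> J \<union> K \<and> k \<in> L \<and> k < j} =
      {(j, k). j \<in> J \<and> k \<in> L \<and> k < j} \<union> {(j, k). j \<in> K \<and> k \<in> L \<and> k < j}"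
    by auto
  then show ?thesis
    using assms unfolding wedge_sign_def power_add [symmetric]
    by (subst card_Un_disjoint [symmetric]) auto
qed

lemma wedge_sign_Un_right:
  assumes "K \<inter> L = {}"
  shows "wedge_sign J (K \<union> L) = wedge_sign J K * wedge_sign J L"
proof -
  have "{(j, k). j \<in> J \<and> k \<in> K \<union> L \<and> k < j} =
      {(j, k). j \<in> J \<and> k \<in> K \<and> k < j} \<union> {(j, k). j \<in> J \<and> k \<in> L \<and> k < j}"
    by auto
  then show ?thesis
    using assms unfolding wedge_sign_def power_add [symmetric]
    by (subst card_Un_disjoint [symmetric]) auto
qed

lemma wedge_sign_square [simp]: "wedge_sign J K * wedge_sign J K = 1"
  by (simp add: wedge_sign_def power_add [symmetric])

text \<open>Both sides sum over the ways to cut \<open>I\<close> into three ordered blocks, with the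
  product of the three pairwise inversion signs. The left side records the union of the first two
  blocks and the first block, the right side the first and the second block.\<close>

lemma wedge_assoc: "(\<alpha> \<and>\<^sub>w \<beta>) \<and>\<^sub>w \<gamma> = \<alpha> \<and>\<^sub>w (\<beta> \<and>\<^sub>w \<gamma>)"
proof -
  have "((\<alpha> \<and>\<^sub>w \<beta>) \<and>\<^sub>w \<gamma>) $ I = (\<alpha> \<and>\<^sub>w (\<beta> \<and>\<^sub>w \<gamma>)) $ I" for I
  proof -
    let ?g = "\<lambda>J K. wedge_sign J (I - J) * wedge_sign K (J - K) * \<alpha> $ K * \<beta> $ (J - K) * \<gamma> $ (I - J)"
    let ?h = "\<lambda>K L. wedge_sign K (I - K) * wedge_sign L (I - K - L) * \<alpha> $ K * \<beta> $ L * \<gamma> $ (I - K - L)"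
    have "((\<alpha> \<and>\<^sub>w \<beta>) \<and>\<^sub>w \<gamma>) $ I = (\<Sum>J\<in>Pow I. \<Sum>K\<in>Pow J. ?g J K)"
      by (simp add: wedge_nth sum_distrib_left sum_distrib_right algebra_simps)
    also have "\<dots> = (\<Sum>(J, K)\<in>Sigma (Pow I) Pow. ?g J K)"
      by (simp add: sum.Sigma)
    also have "\<dots> = (\<Sum>(K, L)\<in>Sigma (Pow I) (\<lambda>K. Pow (I - K)). ?h K L)"
    proof (rule sum.reindex_bij_witness [where j = "\<lambda>(J, K). (K, J - K)" and i = "\<lambda>(K, L). (K \<union> L, K)"])
      fix x assume "x \<in> Sigma (Pow I) Pow"
      then obtain J K where x: "x = (J, K)" "K \<subseteq> J" "J \<subseteq> I" by auto
      have "wedge_sign J (I - J) = wedge_sign K (I - J) * wedge_sign (J - K) (I - J)"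
        using wedge_sign_Un_left [of K "J - K" "I - J"] x by (simp add: Un_absorb1)
      moreover have "wedge_sign K (I - K) = wedge_sign K (J - K) * wedge_sign K (I - J)"
      proof -
        have "I - K = (J - K) \<union> (I - J)" using x by auto
        then show ?thesis
          using wedge_sign_Un_right [of "J - K" "I - J" K] by auto
      qed
      moreover have "I - K - (J - K) = I - J" using x by auto
      ultimately show "(case (case x of (J, K) \<Rightarrow> (K, J - K)) of (K, L) \<Rightarrow> ?h K L) = (case x of (J, K) \<Rightarrow> ?g J K)"
        by (simp add: x algebra_simps)
    qed auto
    also have "\<dots> = (\<Sum>K\<in>Pow I. \<Sum>L\<in>Pow (I - K). ?h K L)"
      by (simp add: sum.Sigma)
    also have "\<dots> = (\<alpha> \<and>\<^sub>w (\<beta> \<and>\<^sub>w \<gamma>)) $ I"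
      by (simp add: wedge_nth sum_distrib_left sum_distrib_right algebra_simps)
    finally show ?thesis .
  qed
  then show ?thesis by (simp add: vec_eq_iff)
qed

lemma axis_nth_if: "axis i x $ j = (if j = i then x else 0)"
  by (simp add: axis_def)

lemma wedge_axis_left_nth:
  "(axis J 1 \<and>\<^sub>w \<beta>) $ I = (if J \<subseteq> I then wedge_sign J (I - J) * \<beta> $ (I - J) else 0)"
proof -
  have "(axis J 1 \<and>\<^sub>w \<beta>) $ I = (\<Sum>K\<in>Pow I. if K = J then wedge_sign J (I - J) * \<beta> $ (I - J) else 0)"
    unfolding wedge_nth by (rule sum.cong) (auto simp: axis_def)
  then show ?thesis by (simp add: sum.delta)
qed

lemma wedge_axis_axis:
  "J \<inter> K = {} \<Longrightarrow> axis J 1 \<and>\<^sub>w axis K 1 = wedge_sign J K *\<^sub>R axis (J \<union> K) 1"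
proof -
  assume disj: "J \<inter> K = {}"
  have "(axis J 1 \<and>\<^sub>w axis K 1) $ I = (wedge_sign J K *\<^sub>R axis (J \<union> K) 1) $ I" for I
  proof (cases "I = J \<union> K")
    case True
    moreover from this disj have "I - J = K" by auto
    ultimately show ?thesis by (simp add: wedge_axis_left_nth)
  next
    case False
    then have "J \<subseteq> I \<longrightarrow> I - J \<noteq> K" by auto
    with False show ?thesis by (simp add: wedge_axis_left_nth axis_nth_if)
  qed
  then show ?thesis by (simp add: vec_eq_iff)
qed

text \<open>The sign in \<open>hodge\<close> is the one with which \<open>J\<close> is wedged with
  its complement, so the two cancel in the top coefficient. Conditions on wedge products with
  \<open>hodge rho0\<close> thereby become orthogonality relations.\<close>

lemma wedge_hodge_top: "(\<alpha> \<and>\<^sub>w hodge \<beta>) $ UNIV = inner \<alpha> \<beta>"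
proof -
  have "wedge_sign J (UNIV - J) * \<alpha> $ J * hodge \<beta> $ (UNIV - J) = \<alpha> $ J * \<beta> $ J" for J
  proof -
    have "wedge_sign J (- J) * \<alpha> $ J * (wedge_sign J (- J) * \<beta> $ J)
        = (wedge_sign J (- J) * wedge_sign J (- J)) * (\<alpha> $ J * \<beta> $ J)"
      by (simp only: ac_simps)
    then show ?thesis by (simp add: hodge_def Compl_eq_Diff_UNIV [symmetric])
  qed
  then show ?thesis by (simp only: wedge_nth inner_vec_def Pow_UNIV inner_real_def)
qed

section \<open>Contraction and its adjointness to the wedge product\<close>

lemma wedge_sign_singleton_left: "wedge_sign {i} K = (- 1) ^ card {k \<in> K. k < i}"
proof -
  have "{(j, k). j \<in> {i} \<and> k \<in> K \<and> k < j} = Pair i ` {k \<in> K. k < i}" by auto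
  then show ?thesis
    by (simp add: wedge_sign_def card_image inj_on_def)
qed

lemma wedge_sign_empty [simp]: "wedge_sign {} K = 1" "wedge_sign J {} = 1"
  by (simp_all add: wedge_sign_def)

lemma wedge_sign_singletons [simp]: "wedge_sign {i} {j} = (if j < i then - 1 else 1)"
proof -
  have "{k \<in> {j}. k < i} = (if j < i then {j} else {})" by auto
  then show ?thesis by (simp add: wedge_sign_singleton_left)
qed

lemma wedge_sign_insert_right:
  "j \<notin> K \<Longrightarrow> wedge_sign {i} (insert j K) = (if j < i then - 1 else 1) * wedge_sign {i} K"
  using wedge_sign_Un_right [of "{j}" K "{i}"] by simp

lemma contract_nth:
  "contract i \<alpha> $ I = (if i \<in> I then 0 else wedge_sign {i} I * \<alpha> $ insert i I)"
  by (simp add: contract_def wedge_sign_singleton_left)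

lemma linear_contract: "linear (contract i)"
  by (rule linearI) (auto simp: vec_eq_iff contract_nth algebra_simps)

lemma contract_Lam: "\<alpha> \<in> Lam (Suc k) \<Longrightarrow> contract i \<alpha> \<in> Lam k"
  by (auto simp: Lam_def contract_nth)

text \<open>Both orders reach the same coefficient; of \<open>wedge_sign {i} {j}\<close> and
  \<open>wedge_sign {j} {i}\<close> exactly one is -1.\<close>

lemma contract_anticommute: "contract i (contract j \<alpha>) = - contract j (contract i \<alpha>)"
proof -
  have "wedge_sign {i} I * (wedge_sign {j} (insert i I) * c) = - (wedge_sign {j} I * (wedge_sign {i} (insert j I) * c))"
    if "i \<noteq> j" "i \<notin> I" "j \<notin> I" for I c
  proof -
    have "wedge_sign {j} (insert i I) = wedge_sign {j} {i} * wedge_sign {j} I"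
      using wedge_sign_Un_right [of "{i}" I "{j}"] that by simp
    moreover have "wedge_sign {i} (insert j I) = wedge_sign {i} {j} * wedge_sign {i} I"
      using wedge_sign_Un_right [of "{j}" I "{i}"] that by simp
    moreover have "wedge_sign {j} {i} = - wedge_sign {i} {j}"
      using that by (cases i j rule: linorder_cases) auto
    ultimately show ?thesis by simp
  qed
  then show ?thesis
    by (auto simp: vec_eq_iff contract_nth insert_commute)
qed

text \<open>Inserting and removing \<open>i\<close> are inverse bijections between the index sets
  without and with \<open>i\<close>, and both operators carry the same sign.\<close>

lemma inner_contract: "inner (contract i \<alpha>) \<beta> = inner \<alpha> (axis {i} 1 \<and>\<^sub>w \<beta>)"
proof -
  have "inner (contract i \<alpha>) \<beta> = (\<Sum>I | i \<notin> I. wedge_sign {i} I * \<alpha> $ insert i I * \<beta> $ I)"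
    by (auto simp: inner_vec_def contract_nth sum.If_cases intro!: sum.mono_neutral_cong_right)
  also have "\<dots> = (\<Sum>I | i \<in> I. \<alpha> $ I * (wedge_sign {i} (I - {i}) * \<beta> $ (I - {i})))"
    by (rule sum.reindex_bij_witness [where j = "insert i" and i = "\<lambda>I. I - {i}"])
      (auto simp: insert_absorb)
  also have "\<dots> = inner \<alpha> (axis {i} 1 \<and>\<^sub>w \<beta>)"
    by (auto simp: inner_vec_def wedge_axis_left_nth intro!: sum.mono_neutral_cong_left split: if_splits)
  finally show ?thesis .
qed

lemma card_2_less_cases:
  fixes I :: "8 set"
  assumes "card I = 2"
  obtains i j where "i < j" "I = {i, j}"
  using assms unfolding card_2_iff by (metis insert_commute linorder_neqE)

lemma contract_set_pair: "i < j \<Longrightarrow> contract_set {i, j} \<alpha> = contract i (contract j \<alpha>)"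
  using sorted_list_of_set.idem_if_sorted_distinct [of "[i, j]"] by (simp add: contract_set_def less_imp_le)

lemma form_eq_sum_axis: "(\<alpha> :: form) = (\<Sum>I\<in>UNIV. \<alpha> $ I *\<^sub>R axis I 1)"
  by (simp add: vec_eq_iff axis_def if_distrib sum.delta cong: if_cong)

lemma Lam_eq_sum_axis:
  assumes "\<alpha> \<in> Lam k"
  shows "\<alpha> = (\<Sum>I | card I = k. \<alpha> $ I *\<^sub>R axis I 1)"
  by (subst form_eq_sum_axis) (use assms in \<open>auto simp: Lam_def intro!: sum.mono_neutral_right\<close>)

text \<open>By linearity in \<open>\<alpha>\<close> it suffices to treat basis pairs. Contracting
  \<open>\<alpha>\<close> twice gives minus its coefficient, and passing to the adjoint reverses the
  two wedge factors; the two minus signs cancel.\<close>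

lemma inner_sigma2:
  assumes "\<alpha> \<in> Lam 2"
  shows "inner (sigma 2 \<alpha> \<beta>) \<zeta> = inner \<beta> (\<alpha> \<and>\<^sub>w \<zeta>)"
proof -
  have *: "inner (contract_set I \<alpha> \<and>\<^sub>w contract_set I \<beta>) \<zeta> = inner \<beta> (\<alpha> $ I *\<^sub>R (axis I 1 \<and>\<^sub>w \<zeta>))"
    if "card I = 2" for I
  proof -
    obtain i j where ij: "i < j" "I = {i, j}"
      using card_2_less_cases \<open>card I = 2\<close> by blast
    have "contract_set I \<alpha> $ K = - (\<alpha> $ I *\<^sub>R axis {} 1) $ K" for K
      using assms ij by (auto simp: contract_set_pair contract_nth axis_def Lam_def
          card_insert_if insert_commute)
    then have "contract_set I \<alpha> = - (\<alpha> $ I *\<^sub>R axis {} 1)" by (simp add: vec_eq_iff)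
    moreover have "axis {} 1 \<and>\<^sub>w \<gamma> = \<gamma>" for \<gamma>
      by (simp add: vec_eq_iff wedge_axis_left_nth wedge_sign_def)
    ultimately have "contract_set I \<alpha> \<and>\<^sub>w contract_set I \<beta> = - (\<alpha> $ I *\<^sub>R contract_set I \<beta>)"
      by (simp add: wedge_minus_left wedge_scaleR_left)
    moreover have "inner (contract_set I \<beta>) \<zeta> = - inner \<beta> (axis I 1 \<and>\<^sub>w \<zeta>)"
    proof -
      have "inner (contract_set I \<beta>) \<zeta> = inner \<beta> ((axis {j} 1 \<and>\<^sub>w axis {i} 1) \<and>\<^sub>w \<zeta>)"
        using ij by (simp add: contract_set_pair inner_contract wedge_assoc)
      also have "axis {j} 1 \<and>\<^sub>w axis {i} 1 = - axis I 1"
        using ij by (subst wedge_axis_axis) (auto simp: insert_commute)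
      finally show ?thesis by (simp add: wedge_minus_left)
    qed
    ultimately show ?thesis by simp
  qed
  have "inner (sigma 2 \<alpha> \<beta>) \<zeta> = (\<Sum>I | card I = 2. inner \<beta> (\<alpha> $ I *\<^sub>R (axis I 1 \<and>\<^sub>w \<zeta>)))"
    using * by (simp add: sigma_def inner_sum_left)
  also have "\<dots> = inner \<beta> ((\<Sum>I | card I = 2. \<alpha> $ I *\<^sub>R axis I 1) \<and>\<^sub>w \<zeta>)"
    by (simp add: wedge_sum_left inner_sum_right wedge_scaleR_left)
  also have "\<dots> = inner \<beta> (\<alpha> \<and>\<^sub>w \<zeta>)"
    using Lam_eq_sum_axis [OF assms] by simp
  finally show ?thesis .
qed

section \<open>Components of forms as alternating tensors\<close>

lemma form_comp_Cons: "form_comp \<alpha> (i # is) = form_comp (contract i \<alpha>) is"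
  by (simp add: form_comp_def)

lemma form_comp_swap: "form_comp \<alpha> (i # j # is) = - form_comp \<alpha> (j # i # is)"
proof -
  have "fold contract is (- \<beta>) = - fold contract is \<beta>" for \<beta>
    by (induction "is" arbitrary: \<beta>) (simp_all add: linear_neg [OF linear_contract])
  then show ?thesis
    by (simp add: form_comp_def contract_anticommute [of j i])
qed

lemma form_comp_swap2: "form_comp \<alpha> (k # i # j # is) = - form_comp \<alpha> (k # j # i # is)"
  by (simp only: form_comp_Cons [of _ k]) (rule form_comp_swap)

lemma linear_form_comp: "linear (\<lambda>\<alpha>. form_comp \<alpha> is)"
proof -
  have "linear (fold contract is)"
    by (induction "is") (auto intro: linear_compose [unfolded o_def] linear_contract simp: linear_id [unfolded id_def] o_def)
  then have "linear ((\<lambda>\<beta>. \<beta> $ {}) \<circ> fold contract is)"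
    by (intro linear_compose) (auto intro: linearI)
  then show ?thesis by (simp add: form_comp_def o_def)
qed

lemma form_comp_2: "i < j \<Longrightarrow> form_comp \<alpha> [i, j] = \<alpha> $ {i, j}"
  by (simp add: form_comp_def contract_nth wedge_sign_insert_right less_imp_neq)

lemma form_comp_3:
  assumes "i < j" "j < k"
  shows "form_comp \<alpha> [i, j, k] = \<alpha> $ {i, j, k}"
proof -
  have "\<not> j < i" "\<not> k < i" "\<not> k < j" "i \<noteq> j" "i \<noteq> k" "j \<noteq> k"
    using assms by (auto dest: less_trans)
  then show ?thesis
    by (simp add: form_comp_def contract_nth wedge_sign_insert_right)
qed

definition alternating3 :: "(8 \<Rightarrow> 8 \<Rightarrow> 8 \<Rightarrow> real) \<Rightarrow> bool" where
  "alternating3 t \<longleftrightarrow> (\<forall>i j k. t i j k = - t j i k \<and> t i j k = - t i k j)"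

lemma alternating3D:
  assumes "alternating3 t"
  shows "t i j k = - t j i k" and "t i j k = - t i k j"
  by (fact assms [unfolded alternating3_def, rule_format, THEN conjunct1],
      fact assms [unfolded alternating3_def, rule_format, THEN conjunct2])

text \<open>A transposition changes both tensors by the same sign and repeated indices give zero, so
  every triple reduces to an increasing one. Since forms are stored by index sets, this is how their
  components are compared with tensors.\<close>

lemma alternating3_eqI:
  assumes s: "alternating3 s" and t: "alternating3 t"
    and eq: "\<And>i j k. i < j \<Longrightarrow> j < k \<Longrightarrow> s i j k = t i j k"
  shows "s i j k = t i j k"
proof -
  note swap = alternating3D [OF t] alternating3D [OF s]
  have rep: "t i i k = 0" "t i k k = 0" "t i k i = 0" "s i i k = 0" "s i k k = 0" "s i k i = 0" for i k
    using swap(1) [of i i k] swap(2) [of i k k] swap(1) [of i k i] swap(2) [of k i i]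
      swap(3) [of i i k] swap(4) [of i k k] swap(3) [of i k i] swap(4) [of k i i]
    by simp_all
  have swap1: "s i j k = t i j k" if "s j i k = t j i k" for i j k
    using that swap(1,3) [of i j k] by simp
  have swap2: "s i j k = t i j k" if "s i k j = t i k j" for i j k
    using that swap(2,4) [of i j k] by simp
  have less: "s i j k = t i j k" if "i < j" for i j k
  proof (cases j k rule: linorder_cases)
    case less
    with that show ?thesis by (rule eq)
  next
    case equal
    with rep show ?thesis by simp
  next
    case greater
    then have "s i k j = t i k j"
      using eq [of i k j] eq [of k i j, THEN swap1] rep that by (cases i k rule: linorder_cases) simp_all
    then show ?thesis by (rule swap2)
  qed
  show ?thesis
    using less [of i j k] less [of j i k, THEN swap1] rep by (cases i j rule: linorder_cases) simp_all
qed

lemma alternating3_form_comp: "alternating3 (\<lambda>i j k. form_comp \<alpha> [i, j, k])"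
  unfolding alternating3_def by (intro allI conjI form_comp_swap form_comp_swap2)

section \<open>The bracket defined by \<open>\<rho>\<close>\<close>

lemma exhaust_8:
  fixes x :: 8
  shows "x = 0 \<or> x = 1 \<or> x = 2 \<or> x = 3 \<or> x = 4 \<or> x = 5 \<or> x = 6 \<or> x = 7"
proof (induct x)
  case (of_int z)
  then have "z = 0 \<or> z = 1 \<or> z = 2 \<or> z = 3 \<or> z = 4 \<or> z = 5 \<or> z = 6 \<or> z = 7" by auto
  then show ?case by auto
qed

lemma forall_8: "(\<forall>i::8. P i) \<longleftrightarrow> P 0 \<and> P 1 \<and> P 2 \<and> P 3 \<and> P 4 \<and> P 5 \<and> P 6 \<and> P 7"
  by (metis exhaust_8)

lemma UNIV_8: "(UNIV :: 8 set) = {0, 1, 2, 3, 4, 5, 6, 7}"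
  using exhaust_8 by auto

lemma sum_8: "sum f (UNIV :: 8 set) = f 0 + f 1 + f 2 + f 3 + f 4 + f 5 + f 6 + f 7"
  unfolding UNIV_8 by (simp add: ac_simps)

lemmas less_8 = less_bit0_def bit0.Rep_numeral bit0.Rep_0 bit0.Rep_1

text \<open>The minor of rows \<open>p\<close>, \<open>q\<close>, \<open>r\<close>: for
  \<open>p < q < r\<close>, the value of the basis form with these indices on three vectors.\<close>

definition det3 :: "8 \<Rightarrow> 8 \<Rightarrow> 8 \<Rightarrow> real^8 \<Rightarrow> real^8 \<Rightarrow> real^8 \<Rightarrow> real" where
  "det3 p q r x y z = x $ p * (y $ q * z $ r - y $ r * z $ q)
     - x $ q * (y $ p * z $ r - y $ r * z $ p) + x $ r * (y $ p * z $ q - y $ q * z $ p)"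

text \<open>The trilinear map of \<open>rho0\<close> as a polynomial in the coordinates, with
  indices shifted to start at 0.\<close>

definition rho3 :: "real^8 \<Rightarrow> real^8 \<Rightarrow> real^8 \<Rightarrow> real" where
  "rho3 x y z = det3 1 3 5 x y z - det3 1 2 4 x y z - det3 0 3 4 x y z - det3 0 2 5 x y z
     + det3 0 1 6 x y z + det3 2 3 6 x y z - 2 * det3 4 5 6 x y z
     + sqrt 3 * (det3 0 1 7 x y z - det3 2 3 7 x y z)"

text \<open>The indices of \<open>ef\<close> drop by one. Each factor \<open>ef [7]\<close> or
  \<open>ef [8]\<close> has a larger index than those before it, so no sign arises.\<close>

lemma rho0_eq_axis:
  "rho0 = axis {1, 3, 5} 1 - axis {1, 2, 4} 1 - axis {0, 3, 4} 1 - axis {0, 2, 5} 1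
     + axis {0, 1, 6} 1 + axis {2, 3, 6} 1 - 2 *\<^sub>R axis {4, 5, 6} 1
     + sqrt 3 *\<^sub>R (axis {0, 1, 7} 1 - axis {2, 3, 7} 1)"
proof -
  have w: "axis {p, q} 1 \<and>\<^sub>w axis {r} 1 = axis {p, q, r} 1" if "p < r" "q < r" for p q r :: 8
  proof -
    have "{(j, k). j \<in> {p, q} \<and> k \<in> {r} \<and> k < j} = {}" using that by auto
    then have "wedge_sign {p, q} {r} = 1" by (simp only: wedge_sign_def card.empty power_0)
    moreover have "{p, q} \<inter> {r} = {}" "{p, q} \<union> {r} = {p, q, r}" using that by auto
    ultimately show ?thesis by (subst wedge_axis_axis) simp_all
  qed
  show ?thesis
    by (simp add: rho0_def ef_def wedge_add_left wedge_diff_left wedge_scaleR_left w less_8)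
qed

text \<open>Both sides alternate, so increasing triples decide. Such a triple is determined by its
  set, and both sides are 1 on the matching triple and 0 on all others.\<close>

lemma det3_form_comp:
  assumes "p < q" "q < r"
  shows "form_comp (axis {p, q, r} 1) [i, j, k] = det3 p q r (axis i 1) (axis j 1) (axis k 1)"
proof (rule alternating3_eqI [where t = "\<lambda>i j k. det3 p q r (axis i 1) (axis j 1) (axis k 1)"])
  show "alternating3 (\<lambda>i j k. form_comp (axis {p, q, r} 1) [i, j, k])"
    by (rule alternating3_form_comp)
  show "alternating3 (\<lambda>i j k. det3 p q r (axis i 1) (axis j 1) (axis k 1))"
    unfolding alternating3_def det3_def by (intro allI conjI) algebra+
next
  fix i j k :: 8
  assume *: "i < j" "j < k"
  have ne: "p \<noteq> q" "q \<noteq> r" "p \<noteq> r" "i \<noteq> j" "j \<noteq> k" "i \<noteq> k" using assms * by auto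
  have "det3 p q r (axis i 1) (axis j 1) (axis k 1) = (if {i, j, k} = {p, q, r} then 1 else 0)"
  proof (cases "{i, j, k} = {p, q, r}")
    case True
    then have "set [i, j, k] = set [p, q, r]" by simp
    moreover have "sorted_list_of_set (set [i, j, k]) = [i, j, k]" "sorted_list_of_set (set [p, q, r]) = [p, q, r]"
      by (rule sorted_list_of_set.idem_if_sorted_distinct; use * assms in auto)+
    ultimately have "i = p \<and> j = q \<and> k = r" by (metis list.inject)
    with ne show ?thesis by (simp add: det3_def axis_nth_if)
  next
    case False
    then have "\<not> (p = a \<and> q = b \<and> r = c)" if "(a, b, c) \<in> {(i,j,k), (i,k,j), (j,i,k), (j,k,i), (k,i,j), (k,j,i)}" for a b c
      using that by auto
    with False ne show ?thesis
      by (simp add: det3_def axis_nth_if) blast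
  qed
  then show "form_comp (axis {p, q, r} 1) [i, j, k] = det3 p q r (axis i 1) (axis j 1) (axis k 1)"
    by (simp add: form_comp_3 * axis_nth_if)
qed

lemma form_comp_rho0: "form_comp rho0 [i, j, k] = rho3 (axis i 1) (axis j 1) (axis k 1)"
proof -
  note lin = linear_add [OF linear_form_comp] linear_diff [OF linear_form_comp] linear_scale [OF linear_form_comp]
  show ?thesis
    by (simp add: rho0_eq_axis lin det3_form_comp less_8 rho3_def)
qed

section \<open>The Lie bracket dual to \<open>rho0\<close>, its Jacobi identity and its Casimir
  operator\<close>

definition struct_const :: "8 \<Rightarrow> 8 \<Rightarrow> 8 \<Rightarrow> real" where
  "struct_const i j k = form_comp rho0 [i, j, k]"

text \<open>Up to scale and identification with 8-space this is the bracket of su(3). Its structure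
  constants in the orthonormal basis are totally skew because they come from a 3-form.\<close>

definition bracket :: "real^8 \<Rightarrow> real^8 \<Rightarrow> real^8" where
  "bracket x y = (\<chi> k. \<Sum>i\<in>UNIV. \<Sum>j\<in>UNIV. x $ i * y $ j * struct_const i j k)"

lemma struct_const_skew: "struct_const i j k = - struct_const j i k" "struct_const i j k = - struct_const i k j"
  unfolding struct_const_def by (rule form_comp_swap, rule form_comp_swap2)

lemma bracket_axis_nth: "bracket (axis i 1) y $ k = (\<Sum>j\<in>UNIV. y $ j * struct_const i j k)"
proof -
  have "bracket (axis i 1) y $ k = (\<Sum>i'\<in>UNIV. if i' = i then \<Sum>j\<in>UNIV. y $ j * struct_const i j k else 0)"
    unfolding bracket_def vec_lambda_beta by (rule sum.cong) (simp_all add: axis_nth_if)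
  then show ?thesis by simp
qed

lemma bracket_axis_axis_nth: "bracket (axis i 1) (axis j 1) $ k = struct_const i j k"
  by (simp add: bracket_axis_nth axis_nth_if if_distrib [of "\<lambda>t. t * _"] cong: if_cong)

lemma linear_rho3: "linear (\<lambda>x. rho3 x y z)" "linear (\<lambda>y. rho3 x y z)" "linear (\<lambda>z. rho3 x y z)"
  by (auto intro!: linearI simp: rho3_def det3_def algebra_simps)

lemma vec_eq_sum_axis: "(x :: real^'n) = (\<Sum>i\<in>UNIV. x $ i *\<^sub>R axis i 1)"
  by (simp add: vec_eq_iff axis_nth_if if_distrib cong: if_cong)

lemma bracket_nth_rho3: "bracket x y $ k = rho3 x y (axis k 1)"
proof -
  have "rho3 x y (axis k 1) = rho3 (\<Sum>i\<in>UNIV. x $ i *\<^sub>R axis i 1) (\<Sum>j\<in>UNIV. y $ j *\<^sub>R axis j 1) (axis k 1)"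
    using vec_eq_sum_axis [of x] vec_eq_sum_axis [of y] by simp
  also have "\<dots> = (\<Sum>i\<in>UNIV. \<Sum>j\<in>UNIV. x $ i * y $ j * struct_const i j k)"
    by (simp add: linear_sum [OF linear_rho3(1)] linear_scale [OF linear_rho3(1)])
      (simp add: linear_sum [OF linear_rho3(2)] linear_scale [OF linear_rho3(2)] struct_const_def form_comp_rho0
        sum_distrib_left mult.assoc)
  finally show ?thesis by (simp add: bracket_def)
qed

lemma bracket_components:
  fixes x y :: "real^8"
  defines "m \<equiv> \<lambda>p q. x $ p * y $ q - x $ q * y $ p"
  shows "bracket x y $ 0 = - m 3 4 - m 2 5 + m 1 6 + sqrt 3 * m 1 7"
    "bracket x y $ 1 = m 3 5 - m 2 4 - m 0 6 - sqrt 3 * m 0 7"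
    "bracket x y $ 2 = m 1 4 + m 0 5 + m 3 6 - sqrt 3 * m 3 7"
    "bracket x y $ 3 = - m 1 5 + m 0 4 - m 2 6 + sqrt 3 * m 2 7"
    "bracket x y $ 4 = - m 1 2 - m 0 3 - 2 * m 5 6"
    "bracket x y $ 5 = m 1 3 - m 0 2 + 2 * m 4 6"
    "bracket x y $ 6 = m 0 1 + m 2 3 - 2 * m 4 5"
    "bracket x y $ 7 = sqrt 3 * (m 0 1 - m 2 3)"
  unfolding m_def bracket_nth_rho3 rho3_def det3_def
  by (simp_all add: axis_nth_if algebra_simps)

lemma sqrt3_mult [simp]: "sqrt 3 * sqrt 3 = 3" "sqrt 3 * (sqrt 3 * x) = 3 * x"
  by (simp_all add: mult.assoc [symmetric])

text \<open>A polynomial identity in each of the eight coordinates; products of the only irrational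
  coefficient \<open>sqrt 3\<close> reduce by \<open>sqrt3_mult\<close>.\<close>

lemma bracket_jacobi: "bracket x (bracket y z) + bracket y (bracket z x) + bracket z (bracket x y) = 0"
  unfolding vec_eq_iff forall_8
  by (intro conjI; simp add: bracket_components algebra_simps)

text \<open>The Casimir operator of the adjoint module. Its scalar is the source of the divisor 12
  in \<open>invariant_in_span_struct_const\<close>.\<close>

lemma bracket_casimir: "(\<Sum>a\<in>UNIV. bracket (axis a 1) (bracket (axis a 1) y)) = - 12 *\<^sub>R y"
  unfolding vec_eq_iff forall_8 sum_8
  by (intro conjI; simp add: bracket_components axis_nth_if algebra_simps)

lemma struct_const_casimir: "(\<Sum>a\<in>UNIV. \<Sum>l\<in>UNIV. struct_const a k l * struct_const a l m) = (if k = m then - 12 else 0)"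
proof -
  have "(\<Sum>a\<in>UNIV. \<Sum>l\<in>UNIV. struct_const a k l * struct_const a l m) = (\<Sum>a\<in>UNIV. bracket (axis a 1) (bracket (axis a 1) (axis k 1))) $ m"
    by (simp add: bracket_axis_nth [of _ "bracket _ _"] bracket_axis_axis_nth)
  then show ?thesis by (simp add: bracket_casimir axis_nth_if)
qed

lemma struct_const_jacobi: "(\<Sum>l\<in>UNIV. struct_const i l m * struct_const j k l + struct_const j l m * struct_const k i l + struct_const k l m * struct_const i j l) = 0"
proof -
  have "(\<Sum>l\<in>UNIV. struct_const i l m * struct_const j k l + struct_const j l m * struct_const k i l + struct_const k l m * struct_const i j l)
    = (bracket (axis i 1) (bracket (axis j 1) (axis k 1)) + bracket (axis j 1) (bracket (axis k 1) (axis i 1))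
       + bracket (axis k 1) (bracket (axis i 1) (axis j 1))) $ m"
    by (simp add: bracket_axis_nth [of _ "bracket _ _"] bracket_axis_axis_nth sum.distrib mult.commute)
  then show ?thesis by (simp add: bracket_jacobi)
qed

text \<open>
  Applying the invariance twice and summing over \<open>a\<close> compares the Casimir operator on the first
  index with the one on the last two; the mixed term is evaluated by the Jacobi identity.
\<close>

lemma invariant_in_span_struct_const:
  fixes A :: "8 \<Rightarrow> 8 \<Rightarrow> 8 \<Rightarrow> real"
  assumes inv: "\<And>a k i j. (\<Sum>l\<in>UNIV. struct_const a k l * A l i j + struct_const a i l * A k l j + struct_const a j l * A k i l) = 0"
    and skew: "\<And>k i j. A k i j = - A k j i"
  shows "A k i j = (\<Sum>a\<in>UNIV. (\<Sum>l\<in>UNIV. \<Sum>m\<in>UNIV. struct_const a l m * A k l m) * struct_const a i j) / 12"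
proof -
  have inv': "(\<Sum>l\<in>UNIV. struct_const a k l * A l i j)
      = - (\<Sum>l\<in>UNIV. struct_const a i l * A k l j) - (\<Sum>l\<in>UNIV. struct_const a j l * A k i l)" for a k i j
    using inv [of a k i j] by (simp add: sum.distrib)
  \<comment> \<open>\<open>Q\<close> is the mixed part of the Casimir operator on the last two
    indices: one structure constant acts on each of them.\<close>
  define Q where "Q = (\<Sum>a\<in>UNIV. \<Sum>l\<in>UNIV. \<Sum>m\<in>UNIV. struct_const a i l * struct_const a j m * A k l m)"
  \<comment> \<open>As \<open>f\<close> is arbitrary, the scalar -12 becomes available in every
    index slot of \<open>A\<close>.\<close>
  have casimir: "(\<Sum>a\<in>UNIV. \<Sum>l\<in>UNIV. struct_const a p l * (\<Sum>m\<in>UNIV. struct_const a l m * f m)) = - 12 * f p" for p f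
  proof -
    have "(\<Sum>a\<in>UNIV. \<Sum>l\<in>UNIV. struct_const a p l * (\<Sum>m\<in>UNIV. struct_const a l m * f m))
        = (\<Sum>a\<in>UNIV. \<Sum>m\<in>UNIV. \<Sum>l\<in>UNIV. struct_const a p l * struct_const a l m * f m)"
      unfolding sum_distrib_left mult.assoc by (rule sum.cong [OF refl sum.swap])
    also have "\<dots> = (\<Sum>m\<in>UNIV. (\<Sum>a\<in>UNIV. \<Sum>l\<in>UNIV. struct_const a p l * struct_const a l m) * f m)"
      unfolding sum_distrib_right by (rule sum.swap)
    also have "\<dots> = (\<Sum>m\<in>UNIV. if m = p then - 12 * f m else 0)"
      by (rule sum.cong) (simp_all add: struct_const_casimir)
    finally show ?thesis by simp
  qed
  \<comment> \<open>Invariance trades the action on the first index for actions on the last two.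
    Where both factors hit \<open>i\<close> the Casimir scalar appears; where one hits
    \<open>j\<close> the result is \<open>Q\<close>.\<close>
  have i_term: "(\<Sum>a\<in>UNIV. \<Sum>p\<in>UNIV. struct_const a k p * (\<Sum>l\<in>UNIV. struct_const a i l * A p l j)) = 12 * A k i j - Q"
  proof -
    have "(\<Sum>a\<in>UNIV. \<Sum>p\<in>UNIV. struct_const a k p * (\<Sum>l\<in>UNIV. struct_const a i l * A p l j))
        = (\<Sum>a\<in>UNIV. \<Sum>l\<in>UNIV. \<Sum>p\<in>UNIV. struct_const a i l * (struct_const a k p * A p l j))"
      unfolding sum_distrib_left mult.left_commute [of "struct_const _ i _"]
      by (rule sum.cong [OF refl sum.swap])
    also have "\<dots> = (\<Sum>a\<in>UNIV. \<Sum>l\<in>UNIV. struct_const a i l *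
        (- (\<Sum>m\<in>UNIV. struct_const a l m * A k m j) - (\<Sum>m\<in>UNIV. struct_const a j m * A k l m)))"
      by (simp only: sum_distrib_left [symmetric] inv')
    also have "\<dots> = 12 * A k i j - Q"
      using casimir [of i "\<lambda>m. A k m j"]
      by (simp add: right_diff_distrib sum_subtractf sum_negf Q_def sum_distrib_left mult.assoc)
    finally show ?thesis .
  qed
  have j_term: "(\<Sum>a\<in>UNIV. \<Sum>p\<in>UNIV. struct_const a k p * (\<Sum>l\<in>UNIV. struct_const a j l * A p i l)) = 12 * A k i j - Q"
  proof -
    have "(\<Sum>a\<in>UNIV. \<Sum>p\<in>UNIV. struct_const a k p * (\<Sum>l\<in>UNIV. struct_const a j l * A p i l))
        = (\<Sum>a\<in>UNIV. \<Sum>l\<in>UNIV. \<Sum>p\<in>UNIV. struct_const a j l * (struct_const a k p * A p i l))"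
      unfolding sum_distrib_left mult.left_commute [of "struct_const _ j _"]
      by (rule sum.cong [OF refl sum.swap])
    also have "\<dots> = (\<Sum>a\<in>UNIV. \<Sum>l\<in>UNIV. struct_const a j l *
        (- (\<Sum>m\<in>UNIV. struct_const a i m * A k m l) - (\<Sum>m\<in>UNIV. struct_const a l m * A k i m)))"
      by (simp only: sum_distrib_left [symmetric] inv')
    also have "\<dots> = 12 * A k i j - (\<Sum>a\<in>UNIV. \<Sum>l\<in>UNIV. \<Sum>m\<in>UNIV. struct_const a j l * (struct_const a i m * A k m l))"
      using casimir [of j "\<lambda>m. A k i m"]
      by (simp add: right_diff_distrib sum_subtractf sum_negf sum_distrib_left mult.assoc)
    also have "(\<Sum>a\<in>UNIV. \<Sum>l\<in>UNIV. \<Sum>m\<in>UNIV. struct_const a j l * (struct_const a i m * A k m l)) = Q"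
      unfolding Q_def by (subst sum.swap) (simp add: ac_simps)
    finally show ?thesis .
  qed
  \<comment> \<open>The Casimir operator on the first index gives the left side; by invariance it is
    also minus the sum of the two terms just computed.\<close>
  have "- 12 * A k i j = - (12 * A k i j - Q) - (12 * A k i j - Q)"
    using casimir [of k "\<lambda>l. A l i j"] unfolding inv'
    by (simp add: right_diff_distrib sum_subtractf sum_negf i_term j_term)
  then have "A k i j = (Q + Q) / 12" by simp
  also have "Q + Q = (\<Sum>a\<in>UNIV. (\<Sum>l\<in>UNIV. \<Sum>m\<in>UNIV. struct_const a l m * A k l m) * struct_const a i j)"
  proof -
    \<comment> \<open>Against the skew \<open>A\<close> only the part of \<open>R\<close> skew in
      \<open>l\<close> and \<open>m\<close> survives, and the Jacobi identity factors that part
      through \<open>struct_const a i j\<close>.\<close>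
    define R where "R l m = (\<Sum>a\<in>UNIV. struct_const a i l * struct_const a j m)" for l m
    have R: "R l m - R m l = (\<Sum>a\<in>UNIV. struct_const a i j * struct_const a l m)" for l m
    proof -
      \<comment> \<open>Total skewness rearranges the summand of the Jacobi identity for
        \<open>i\<close>, \<open>l\<close>, \<open>j\<close> into the products occurring in
        \<open>R\<close>.\<close>
      have "struct_const i a m * struct_const l j a + struct_const l a m * struct_const j i a + struct_const j a m * struct_const i l a
          = struct_const a i j * struct_const a l m - (struct_const a i l * struct_const a j m - struct_const a i m * struct_const a j l)" for a
        using struct_const_skew(1) [of i a m] struct_const_skew(1) [of l a m] struct_const_skew(1) [of j a m]
          struct_const_skew(2) [of l j a] struct_const_skew(1) [of l a j] struct_const_skew(2) [of a l j]
          struct_const_skew(2) [of j i a] struct_const_skew(1) [of j a i] struct_const_skew(2) [of a j i]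
          struct_const_skew(2) [of i l a] struct_const_skew(1) [of i a l]
        by simp
      then show ?thesis
        using struct_const_jacobi [of i m l j] by (simp add: R_def sum_subtractf)
    qed
    have Q1: "Q = (\<Sum>l\<in>UNIV. \<Sum>m\<in>UNIV. R l m * A k l m)"
      unfolding Q_def R_def sum_distrib_right
      by (subst sum.swap) (rule sum.cong [OF refl sum.swap])
    also have "\<dots> = (\<Sum>l\<in>UNIV. \<Sum>m\<in>UNIV. R m l * A k m l)"
      by (rule sum.swap)
    also have "\<dots> = (\<Sum>l\<in>UNIV. \<Sum>m\<in>UNIV. - (R m l * A k l m))"
      by (subst skew) simp
    finally have "Q + Q = (\<Sum>l\<in>UNIV. \<Sum>m\<in>UNIV. (R l m - R m l) * A k l m)"
      using Q1 by (simp add: left_diff_distrib sum_subtractf sum_negf)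
    also have "\<dots> = (\<Sum>l\<in>UNIV. \<Sum>m\<in>UNIV. \<Sum>a\<in>UNIV. struct_const a l m * A k l m * struct_const a i j)"
      unfolding R sum_distrib_right by (simp add: ac_simps)
    also have "\<dots> = (\<Sum>l\<in>UNIV. \<Sum>a\<in>UNIV. \<Sum>m\<in>UNIV. struct_const a l m * A k l m * struct_const a i j)"
      by (rule sum.cong [OF refl sum.swap])
    also have "\<dots> = (\<Sum>a\<in>UNIV. \<Sum>l\<in>UNIV. \<Sum>m\<in>UNIV. struct_const a l m * A k l m * struct_const a i j)"
      by (rule sum.swap)
    finally show ?thesis unfolding sum_distrib_right .
  qed
  finally show ?thesis .
qed

section \<open>One-parameter groups of matrices\<close>

text \<open>
  A copy of the bounded endomorphisms that is an instance of the Banach algebra classes, which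
  \<^typ>\<open>'a \<Rightarrow>\<^sub>L 'b\<close> cannot be; it gives access to \<^const>\<open>exp\<close>.
\<close>

typedef (overloaded) ('a :: euclidean_space) endo = "UNIV :: ('a \<Rightarrow>\<^sub>L 'a) set" ..

setup_lifting type_definition_endo

instantiation endo :: (euclidean_space) real_normed_algebra_1
begin

lift_definition zero_endo :: "'a endo" is 0 .
lift_definition one_endo :: "'a endo" is id_blinfun .
lift_definition plus_endo :: "'a endo \<Rightarrow> 'a endo \<Rightarrow> 'a endo" is "(+)" .
lift_definition minus_endo :: "'a endo \<Rightarrow> 'a endo \<Rightarrow> 'a endo" is "(-)" .
lift_definition uminus_endo :: "'a endo \<Rightarrow> 'a endo" is uminus .
lift_definition times_endo :: "'a endo \<Rightarrow> 'a endo \<Rightarrow> 'a endo" is "(o\<^sub>L)" .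
lift_definition scaleR_endo :: "real \<Rightarrow> 'a endo \<Rightarrow> 'a endo" is scaleR .
lift_definition norm_endo :: "'a endo \<Rightarrow> real" is norm .

definition dist_endo :: "'a endo \<Rightarrow> 'a endo \<Rightarrow> real" where "dist_endo x y = norm (x - y)"
definition sgn_endo :: "'a endo \<Rightarrow> 'a endo" where "sgn_endo x = inverse (norm x) *\<^sub>R x"
definition uniformity_endo :: "('a endo \<times> 'a endo) filter" where
  "uniformity_endo = (INF e\<in>{0 <..}. principal {(x, y). dist x y < e})"
definition open_endo :: "'a endo set \<Rightarrow> bool" where
  "open_endo U = (\<forall>x\<in>U. eventually (\<lambda>(x', y). x' = x \<longrightarrow> y \<in> U) uniformity)"

instance
proof
  fix a b c :: "'a endo" and r s :: real
  show "a + b + c = a + (b + c)" by transfer (simp add: algebra_simps)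
  show "a + b = b + a" by transfer simp
  show "0 + a = a" by transfer simp
  show "- a + a = 0" by transfer simp
  show "a - b = a + - b" by transfer simp
  show "r *\<^sub>R (a + b) = r *\<^sub>R a + r *\<^sub>R b" by transfer (simp add: algebra_simps)
  show "(r + s) *\<^sub>R a = r *\<^sub>R a + s *\<^sub>R a" by transfer (simp add: algebra_simps)
  show "r *\<^sub>R s *\<^sub>R a = (r * s) *\<^sub>R a" by transfer simp
  show "1 *\<^sub>R a = a" by transfer simp
  show "a * b * c = a * (b * c)" by transfer (auto intro!: blinfun_eqI)
  show "1 * a = a" by transfer (auto intro!: blinfun_eqI)
  show "a * 1 = a" by transfer (auto intro!: blinfun_eqI)
  show "(0 :: 'a endo) \<noteq> 1"
  proof transfer
    have "norm (id_blinfun :: 'a \<Rightarrow>\<^sub>L 'a) \<noteq> norm (0 :: 'a \<Rightarrow>\<^sub>L 'a)" by simp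
    then show "(0 :: 'a \<Rightarrow>\<^sub>L 'a) \<noteq> id_blinfun" by (rule contrapos_nn) (erule arg_cong [OF sym])
  qed
  show "(a + b) * c = a * c + b * c" by transfer (auto intro!: blinfun_eqI simp: blinfun.bilinear_simps)
  show "a * (b + c) = a * b + a * c" by transfer (auto intro!: blinfun_eqI simp: blinfun.bilinear_simps)
  show "r *\<^sub>R a * b = r *\<^sub>R (a * b)" by transfer (auto intro!: blinfun_eqI simp: blinfun.bilinear_simps)
  show "a * r *\<^sub>R b = r *\<^sub>R (a * b)" by transfer (auto intro!: blinfun_eqI simp: blinfun.bilinear_simps)
  show "dist a b = norm (a - b)" by (rule dist_endo_def)
  show "sgn a = inverse (norm a) *\<^sub>R a" by (rule sgn_endo_def)
  show "(uniformity :: ('a endo \<times> 'a endo) filter) = (INF e\<in>{0 <..}. principal {(x, y). dist x y < e})"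
    by (rule uniformity_endo_def)
  show "open U = (\<forall>x\<in>U. eventually (\<lambda>(x', y). x' = x \<longrightarrow> y \<in> U) uniformity)" for U :: "'a endo set"
    by (rule open_endo_def)
  show "(norm a = 0) = (a = 0)" by transfer simp
  show "norm (a + b) \<le> norm a + norm b" by transfer (rule norm_triangle_ineq)
  show "norm (r *\<^sub>R a) = \<bar>r\<bar> * norm a" by transfer simp
  show "norm (a * b) \<le> norm a * norm b" by transfer (rule norm_blinfun_compose)
  show "norm (1 :: 'a endo) = 1" by transfer simp
qed

end

text \<open>\<open>Rep_endo\<close> is an isometry onto a complete space, so limits can be pulled
  back.\<close>

instance endo :: (euclidean_space) banach
proof
  fix X :: "nat \<Rightarrow> 'a endo"
  have dist: "dist (Rep_endo x) (Rep_endo y) = dist x y" for x y :: "'a endo"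
    unfolding dist_norm by transfer simp
  assume "Cauchy X"
  then have "Cauchy (\<lambda>n. Rep_endo (X n))" by (simp add: Cauchy_def dist)
  then obtain L where "(\<lambda>n. Rep_endo (X n)) \<longlonglongrightarrow> L" by (auto simp: Cauchy_convergent_iff convergent_def)
  then have "(\<lambda>n. Rep_endo (X n)) \<longlonglongrightarrow> Rep_endo (Abs_endo L)" by (simp add: Abs_endo_inverse)
  then have "X \<longlonglongrightarrow> Abs_endo L" by (simp add: tendsto_iff dist)
  then show "convergent X" by (auto simp: convergent_def)
qed

text \<open>The group is exp(tB), formed in \<open>endo\<close> and carried over to matrices. Since
  \<open>lie_algebra\<close> asks for a whole one-parameter group, membership proofs need such a
  construction.\<close>

lemma one_parameter_group_exists:
  fixes B :: "real^'n^'n"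
  obtains h :: "real \<Rightarrow> real^'n^'n"
  where "\<And>s t. h (s + t) = h s ** h t" "h 0 = mat 1" "(h has_vector_derivative B) (at 0)"
proof -
  \<comment> \<open>\<open>mx\<close> is a bounded unital algebra homomorphism, so it preserves the
    group law and the derivative of the exponential curve.\<close>
  define mx :: "(real^'n) endo \<Rightarrow> real^'n^'n" where "mx x = matrix (blinfun_apply (Rep_endo x))" for x
  have nth: "mx x $ i $ j = Rep_endo x (axis j 1) $ i" for x i j
    by (simp add: mx_def matrix_def)
  have "bounded_linear mx"
  proof (rule bounded_linear_intro)
    show "mx (x + y) = mx x + mx y" for x y
      by (simp add: vec_eq_iff nth plus_endo.rep_eq blinfun.bilinear_simps)
    show "mx (r *\<^sub>R x) = r *\<^sub>R mx x" for r x
      by (simp add: vec_eq_iff nth scaleR_endo.rep_eq blinfun.bilinear_simps)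
    fix x
    have "norm (mx x) \<le> (\<Sum>i\<in>UNIV. norm (mx x $ i))"
      unfolding norm_vec_def by (rule L2_set_le_sum) simp
    also have "\<dots> \<le> (\<Sum>i\<in>UNIV. \<Sum>j\<in>UNIV. \<bar>mx x $ i $ j\<bar>)"
      by (intro sum_mono norm_le_l1_cart)
    also have "\<dots> \<le> (\<Sum>i\<in>(UNIV :: 'n set). \<Sum>j\<in>(UNIV :: 'n set). norm x)"
    proof (intro sum_mono)
      fix i j :: 'n
      have "\<bar>mx x $ i $ j\<bar> \<le> norm (Rep_endo x (axis j 1))"
        unfolding nth by (rule component_le_norm_cart)
      also have "\<dots> \<le> norm (Rep_endo x) * norm (axis j 1 :: real^'n)" by (rule norm_blinfun)
      finally show "\<bar>mx x $ i $ j\<bar> \<le> norm x" by (simp add: norm_endo.rep_eq)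
    qed
    also have "\<dots> = norm x * (real CARD('n) * real CARD('n))" by simp
    finally show "norm (mx x) \<le> norm x * (real CARD('n) * real CARD('n))" .
  qed
  have mult: "mx (x * y) = mx x ** mx y" for x y
    unfolding mx_def times_endo.rep_eq blinfun_compose.rep_eq
    by (intro matrix_compose bounded_linear.linear blinfun.bounded_linear_right)
  have one: "mx 1 = mat 1"
    by (simp add: vec_eq_iff nth one_endo.rep_eq mat_def axis_def)
  define b where "b = Abs_endo (Blinfun ((*v) B))"
  have "blinfun_apply (Rep_endo b) = (*v) B"
    by (simp add: b_def Abs_endo_inverse bounded_linear_Blinfun_apply matrix_vector_mul_bounded_linear)
  then have b: "mx b = B" by (simp add: mx_def)
  define h where "h t = mx (exp (t *\<^sub>R b))" for t
  show thesis
  proof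
    show "h (s + t) = h s ** h t" for s t
      unfolding h_def mult [symmetric]
      by (subst exp_add_commuting [symmetric]) (simp_all add: scaleR_add_left)
    show "h 0 = mat 1" by (simp add: h_def one)
    have "((\<lambda>t. exp (t *\<^sub>R b)) has_vector_derivative exp (0 *\<^sub>R b) * b) (at 0)"
      by (rule exp_scaleR_has_vector_derivative_right)
    from bounded_linear.has_vector_derivative [OF \<open>bounded_linear mx\<close> this]
    show "(h has_vector_derivative B) (at 0)" by (simp add: h_def [abs_def] b)
  qed
qed

section \<open>Covariant 2- and 3-tensors\<close>

lemma teval_2: "teval t [x, y] = (\<Sum>i\<in>UNIV. \<Sum>j\<in>UNIV. t [i, j] * (x $ i * y $ j))"
proof -
  have "teval t [x, y] = (\<Sum>(i, j)\<in>UNIV \<times> UNIV. t [i, j] * (x $ i * y $ j))"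
    unfolding teval_def
    by (rule sum.reindex_bij_witness [where i = "\<lambda>(i, j). [i, j]" and j = "\<lambda>js. (js ! 0, js ! 1)"])
      (auto simp: length_Suc_conv eval_nat_numeral lessThan_Suc mult.commute)
  then show ?thesis by (simp add: sum.cartesian_product)
qed

lemma teval_3: "teval t [x, y, z] = (\<Sum>i\<in>UNIV. \<Sum>j\<in>UNIV. \<Sum>k\<in>UNIV. t [i, j, k] * (x $ i * y $ j * z $ k))"
proof -
  have "teval t [x, y, z] = (\<Sum>(i, j, k)\<in>UNIV \<times> UNIV \<times> UNIV. t [i, j, k] * (x $ i * y $ j * z $ k))"
    unfolding teval_def
    by (rule sum.reindex_bij_witness [where i = "\<lambda>(i, j, k). [i, j, k]" and j = "\<lambda>js. (js ! 0, js ! 1, js ! 2)"])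
      (auto simp: length_Suc_conv eval_nat_numeral lessThan_Suc ac_simps)
  then show ?thesis by (simp add: sum.cartesian_product)
qed

lemma linear_teval_3:
  "linear (\<lambda>x. teval t [x, y, z])" "linear (\<lambda>y. teval t [x, y, z])" "linear (\<lambda>z. teval t [x, y, z])"
  unfolding teval_3
  by (auto intro!: linearI simp: sum.distrib distrib_left distrib_right sum_distrib_left ac_simps)

lemma linear_teval_2: "linear (\<lambda>x. teval t [x, y])" "linear (\<lambda>y. teval t [x, y])"
  unfolding teval_2
  by (auto intro!: linearI simp: sum.distrib distrib_left distrib_right sum_distrib_left ac_simps)

lemma teval_3_axis: "teval t [axis i 1, axis j 1, axis k 1] = t [i, j, k]"
proof -
  have delta: "(\<Sum>a\<in>UNIV. f a * axis b 1 $ a) = f b" for f :: "8 \<Rightarrow> real" and b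
    by (simp add: axis_nth_if if_distrib cong: if_cong)
  have "teval t [x, y, z] = (\<Sum>i\<in>UNIV. (\<Sum>j\<in>UNIV. (\<Sum>k\<in>UNIV. t [i, j, k] * z $ k) * y $ j) * x $ i)" for x y z
    by (simp add: teval_3 sum_distrib_left sum_distrib_right ac_simps)
  then show ?thesis by (simp add: delta)
qed

lemma has_real_derivative_vec_nth:
  "(f has_vector_derivative f') (at t) \<Longrightarrow> ((\<lambda>t. f t $ i) has_real_derivative f' $ i) (at t)"
  using bounded_linear.has_vector_derivative [OF bounded_linear_vec_nth]
  by (simp add: has_real_derivative_iff_has_vector_derivative)

text \<open>The product rule when the coefficients and all three arguments vary. For constant
  coefficients it is used with \<open>c'\<close> equal to zero.\<close>

lemma teval_3_has_real_derivative:
  assumes c: "\<And>i j k. ((\<lambda>t. c t [i, j, k]) has_real_derivative c' [i, j, k]) (at t)"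
    and x: "(x has_vector_derivative x') (at t)"
    and y: "(y has_vector_derivative y') (at t)"
    and z: "(z has_vector_derivative z') (at t)"
  shows "((\<lambda>t. teval (c t) [x t, y t, z t]) has_real_derivative
    teval c' [x t, y t, z t] + teval (c t) [x', y t, z t] + teval (c t) [x t, y', z t] + teval (c t) [x t, y t, z'])
    (at t)"
proof -
  note nth = has_real_derivative_vec_nth [OF x] has_real_derivative_vec_nth [OF y] has_real_derivative_vec_nth [OF z]
  have "((\<lambda>t. c t [i, j, k] * (x t $ i * y t $ j * z t $ k)) has_real_derivative
      c' [i, j, k] * (x t $ i * y t $ j * z t $ k) + c t [i, j, k] * (x' $ i * y t $ j * z t $ k)
      + c t [i, j, k] * (x t $ i * y' $ j * z t $ k) + c t [i, j, k] * (x t $ i * y t $ j * z' $ k)) (at t)" for i j k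
    by (rule derivative_eq_intros c nth refl)+ (simp add: algebra_simps)
  then have "((\<lambda>t. teval (c t) [x t, y t, z t]) has_real_derivative
      (\<Sum>i\<in>UNIV. \<Sum>j\<in>UNIV. \<Sum>k\<in>UNIV.
        c' [i, j, k] * (x t $ i * y t $ j * z t $ k) + c t [i, j, k] * (x' $ i * y t $ j * z t $ k)
        + c t [i, j, k] * (x t $ i * y' $ j * z t $ k) + c t [i, j, k] * (x t $ i * y t $ j * z' $ k))) (at t)"
    unfolding teval_3 by (intro DERIV_sum)
  then show ?thesis by (simp add: teval_3 sum.distrib)
qed

text \<open>The group law turns the difference quotient at \<open>t\<close> into the one at 0, taken
  at the vector \<open>h t *v x\<close>.\<close>

lemma one_parameter_group_has_vector_derivative:
  fixes h :: "real \<Rightarrow> real^8^8"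
  assumes h: "\<And>s t. h (s + t) = h s ** h t" "(h has_vector_derivative B) (at 0)"
  shows "((\<lambda>t. h t *v x) has_vector_derivative B *v (h t *v x)) (at t)"
proof -
  have "bounded_linear (\<lambda>M :: real^8^8. M *v y)" for y
    by (intro linear_conv_bounded_linear [THEN iffD1] linearI)
      (simp_all add: matrix_vector_mult_add_rdistrib scaleR_matrix_vector_assoc)
  then have "((\<lambda>s. h s *v (h t *v x)) has_vector_derivative B *v (h t *v x)) (at 0)"
    by (rule bounded_linear.has_vector_derivative) (rule h(2))
  then have "((\<lambda>s. h (s + t) *v x) has_vector_derivative B *v (h t *v x)) (at (t - t))"
    by (simp add: h(1) matrix_vector_mul_assoc)
  then have "(((\<lambda>s. h (s + t) *v x) \<circ> (\<lambda>s. s - t)) has_vector_derivative 1 *\<^sub>R (B *v (h t *v x))) (at t)"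
    by (intro vector_diff_chain_at) (auto intro!: derivative_eq_intros)
  then show ?thesis by (simp add: o_def)
qed

text \<open>Along the one-parameter group with velocity \<open>B\<close> the value of the tensor is
  constant; the left side is its derivative at time 0.\<close>

lemma lie_algebra_annihilates:
  assumes B: "B \<in> lie_algebra H"
    and H: "\<And>P x y z. P \<in> H \<Longrightarrow> teval \<tau> [P *v x, P *v y, P *v z] = teval \<tau> [x, y, z]"
  shows "teval \<tau> [B *v x, y, z] + teval \<tau> [x, B *v y, z] + teval \<tau> [x, y, B *v z] = 0"
proof -
  obtain h where h: "\<And>s t. h (s + t) = h s ** h t" "h 0 = mat 1" "(h has_vector_derivative B) (at 0)" "\<And>t. h t \<in> H"
    using B unfolding lie_algebra_def by blast
  note d = one_parameter_group_has_vector_derivative [OF h(1,3), where t = 0, unfolded h(2) matrix_vector_mul_lid]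
  have "((\<lambda>t. teval \<tau> [h t *v x, h t *v y, h t *v z]) has_real_derivative
    teval (\<lambda>_. 0) [h 0 *v x, h 0 *v y, h 0 *v z] + teval \<tau> [B *v x, h 0 *v y, h 0 *v z]
     + teval \<tau> [h 0 *v x, B *v y, h 0 *v z] + teval \<tau> [h 0 *v x, h 0 *v y, B *v z]) (at 0)"
    by (rule teval_3_has_real_derivative) (simp_all add: d)
  then have "((\<lambda>t. teval \<tau> [x, y, z]) has_real_derivative
    teval \<tau> [B *v x, y, z] + teval \<tau> [x, B *v y, z] + teval \<tau> [x, y, B *v z]) (at (0::real))"
    by (simp add: H h teval_3 [of "\<lambda>_. 0"])
  then show ?thesis using DERIV_unique [OF _ DERIV_const] by blast
qed

section \<open>The Lie algebra of \<open>PSU(3)\<close>\<close>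

lemma inner_bracket: "inner (bracket x y) z = rho3 x y z"
proof -
  have "rho3 x y z = rho3 x y (\<Sum>k\<in>UNIV. z $ k *\<^sub>R axis k 1)"
    using vec_eq_sum_axis [of z] by simp
  also have "\<dots> = inner (bracket x y) z"
    by (simp add: linear_sum [OF linear_rho3(3)] linear_scale [OF linear_rho3(3)] inner_vec_def bracket_nth_rho3 mult.commute)
  finally show ?thesis ..
qed

lemma teval_rho0: "teval (form_comp rho0) [x, y, z] = inner (bracket x y) z"
proof -
  have "inner (bracket x y) z = (\<Sum>k\<in>UNIV. \<Sum>i\<in>UNIV. \<Sum>j\<in>UNIV. struct_const i j k * (x $ i * y $ j * z $ k))"
    by (simp add: inner_vec_def bracket_def sum_distrib_left sum_distrib_right ac_simps)
  also have "\<dots> = (\<Sum>i\<in>UNIV. \<Sum>k\<in>UNIV. \<Sum>j\<in>UNIV. struct_const i j k * (x $ i * y $ j * z $ k))"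
    by (rule sum.swap)
  also have "\<dots> = (\<Sum>i\<in>UNIV. \<Sum>j\<in>UNIV. \<Sum>k\<in>UNIV. struct_const i j k * (x $ i * y $ j * z $ k))"
    by (rule sum.cong [OF refl sum.swap])
  finally show ?thesis by (simp add: teval_3 struct_const_def)
qed

lemma bracket_commute: "bracket x y = - bracket y x"
proof -
  have "rho3 x y z = - rho3 y x z" for z by (simp add: rho3_def det3_def algebra_simps)
  then show ?thesis by (simp add: vec_eq_iff bracket_nth_rho3)
qed

lemma inner_bracket_skew: "inner (bracket w x) y = - inner x (bracket w y)"
  by (simp add: inner_bracket inner_commute [of x] rho3_def det3_def algebra_simps)

lemma linear_bracket: "linear (bracket w)"
  by (rule linearI) (simp_all add: vec_eq_iff bracket_def sum.distrib sum_distrib_left algebra_simps)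

lemma card_less_3_cases:
  fixes I :: "8 set"
  assumes "card I = 3"
  obtains i j k where "i < j" "j < k" "I = {i, j, k}" "sorted_list_of_set I = [i, j, k]"
proof -
  define l where "l = sorted_list_of_set I"
  have "length l = 3" "set l = I" "sorted l" "distinct l"
    using assms by (simp_all add: l_def)
  moreover from \<open>length l = 3\<close> obtain i j k where "l = [i, j, k]"
    by (auto simp: length_Suc_conv eval_nat_numeral)
  ultimately show thesis by (intro that [of i j k]) (auto simp: l_def [symmetric])
qed

lemma rho0_Lam: "rho0 \<in> Lam 3"
  by (auto simp: Lam_def rho0_eq_axis axis_nth_if)

text \<open>Along the one-parameter group of \<open>B\<close> the inner products and the values of
  \<open>rho0\<close> have derivative zero, so they keep their values at time 0 and the group stays
  in \<open>PSU3\<close>.\<close>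

lemma psu3I:
  assumes skew: "\<And>x y. inner (B *v x) y = - inner x (B *v y)"
    and der: "\<And>x y z. inner (bracket (B *v x) y) z + inner (bracket x (B *v y)) z + inner (bracket x y) (B *v z) = 0"
  shows "B \<in> psu3"
proof -
  obtain h where h: "\<And>s t. h (s + t) = h s ** h t" "h 0 = mat 1" "(h has_vector_derivative B) (at 0)"
    using one_parameter_group_exists [of B] by blast
  note d = one_parameter_group_has_vector_derivative [OF h(1,3)]
  have inner: "inner (h t *v x) (h t *v y) = inner x y" for t x y
  proof -
    have "((\<lambda>t. inner (h t *v x) (h t *v y)) has_vector_derivative
        inner (h t *v x) (B *v (h t *v y)) + inner (B *v (h t *v x)) (h t *v y)) (at t)" for t
      by (rule bounded_bilinear.has_vector_derivative [OF bounded_bilinear_inner d d])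
    then have "\<forall>t. ((\<lambda>t. inner (h t *v x) (h t *v y)) has_real_derivative 0) (at t)"
      by (simp add: skew has_real_derivative_iff_has_vector_derivative)
    from DERIV_isconst_all [OF this, of t 0] show ?thesis by (simp add: h(2))
  qed
  have rho: "inner (bracket (h t *v x) (h t *v y)) (h t *v z) = inner (bracket x y) z" for t x y z
  proof -
    have "((\<lambda>t. teval (form_comp rho0) [h t *v x, h t *v y, h t *v z]) has_real_derivative
        teval (\<lambda>_. 0) [h t *v x, h t *v y, h t *v z]
        + teval (form_comp rho0) [B *v (h t *v x), h t *v y, h t *v z]
        + teval (form_comp rho0) [h t *v x, B *v (h t *v y), h t *v z]
        + teval (form_comp rho0) [h t *v x, h t *v y, B *v (h t *v z)]) (at t)" for t
      by (rule teval_3_has_real_derivative) (simp_all add: d)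
    then have "\<forall>t. ((\<lambda>t. inner (bracket (h t *v x) (h t *v y)) (h t *v z)) has_real_derivative 0) (at t)"
      by (simp add: teval_3 [of "\<lambda>_. 0"] teval_rho0 der)
    from DERIV_isconst_all [OF this, of t 0] show ?thesis by (simp add: h(2))
  qed
  have orth: "orthogonal_matrix (h t)" for t
    using orthogonal_transformation_matrix [of "(*v) (h t)"]
    by (simp add: orthogonal_transformation_def inner)
  have "h t \<in> PSU3" for t
  proof -
    \<comment> \<open>Halving the time exhibits the determinant as the square of 1 or -1.\<close>
    have "det (h t) = det (h (t / 2)) * det (h (t / 2))"
      using h(1) [of "t / 2" "t / 2"] by (simp add: det_mul)
    then have "det (h t) = 1"
      using det_orthogonal_matrix [OF orth, of "t / 2"] by auto
    moreover have "frame_form 3 (form_comp rho0) (h t) $ I = rho0 $ I" for I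
    proof (cases "card I = 3")
      case True
      then obtain i j k where I: "i < j" "j < k" "I = {i, j, k}" "sorted_list_of_set I = [i, j, k]"
        by (rule card_less_3_cases)
      have "frame_form 3 (form_comp rho0) (h t) $ I
          = teval (form_comp rho0) [h t *v axis i 1, h t *v axis j 1, h t *v axis k 1]"
        using True I(4) by (simp add: frame_form_def matrix_vector_mul_component matrix_vector_mult_basis)
      also have "\<dots> = teval (form_comp rho0) [axis i 1, axis j 1, axis k 1]"
        by (simp add: teval_rho0 rho)
      also have "\<dots> = rho0 $ I"
        using I by (simp add: teval_3_axis form_comp_3)
      finally show ?thesis .
    next
      case False
      then show ?thesis using rho0_Lam by (simp add: frame_form_def Lam_def)
    qed
    ultimately show ?thesis using orth by (simp add: PSU3_def vec_eq_iff)
  qed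
  then show ?thesis
    using h by (auto simp: psu3_def lie_algebra_def)
qed

text \<open>Skewness comes from the total skewness of \<open>rho0\<close>, the derivation property
  from the Jacobi identity. These are the elements of \<open>psu3\<close> through which the holonomy
  hypothesis is exploited.\<close>

lemma ad_in_psu3: "matrix (bracket w) \<in> psu3"
proof (rule psu3I)
  have ad: "matrix (bracket w) *v x = bracket w x" for x
    by (simp add: matrix_works linear_bracket)
  show "inner (matrix (bracket w) *v x) y = - inner x (matrix (bracket w) *v y)" for x y
    by (simp add: ad inner_bracket_skew)
  fix x y z
  have "bracket (bracket w x) y + bracket x (bracket w y) - bracket w (bracket x y) = 0"
    using bracket_jacobi [of w x y] bracket_commute [of y "bracket w x"] bracket_commute [of y w]
      linear_neg [OF linear_bracket, of x "bracket w y"] by (simp add: diff_eq_eq)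
  then have "inner (bracket (bracket w x) y + bracket x (bracket w y) - bracket w (bracket x y)) z = 0" by simp
  then show "inner (bracket (matrix (bracket w) *v x) y) z + inner (bracket x (matrix (bracket w) *v y)) z
      + inner (bracket x y) (matrix (bracket w) *v z) = 0"
    by (simp add: ad inner_add_left inner_diff_left inner_bracket_skew [of w "bracket x y"])
qed

section \<open>The intrinsic torsion modules\<close>

lemma subspace_Lam2_20: "subspace Lam2_20"
  by (auto simp: Lam2_20_def Lam_def wedge_add_left wedge_scaleR_left intro!: subspaceI)

text \<open>This resolves the \<open>THE\<close> in \<open>orth_proj\<close>: two candidates differ
  by an element of \<open>Lam2_20\<close> that is orthogonal to itself.\<close>

lemma pr_m_unique:
  assumes "\<eta> \<in> Lam2_20" "\<And>\<zeta>. \<zeta> \<in> Lam2_20 \<Longrightarrow> inner (\<omega> - \<eta>) \<zeta> = 0"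
  shows "pr_m \<omega> = \<eta>"
  unfolding pr_m_def orth_proj_def
proof (rule the_equality)
  fix \<eta>' assume \<eta>': "\<eta>' \<in> Lam2_20 \<and> (\<forall>\<zeta>\<in>Lam2_20. inner (\<omega> - \<eta>') \<zeta> = 0)"
  have d: "\<eta>' - \<eta> \<in> Lam2_20"
    using \<eta>' assms(1) subspace_Lam2_20 by (simp add: subspace_diff)
  have "inner (\<eta>' - \<eta>) (\<eta>' - \<eta>) = inner (\<omega> - \<eta>) (\<eta>' - \<eta>) - inner (\<omega> - \<eta>') (\<eta>' - \<eta>)"
    by (simp add: inner_diff_left)
  also have "\<dots> = 0"
    using assms(2) [OF d] bspec [OF conjunct2 [OF \<eta>'] d] by simp
  finally show "\<eta>' = \<eta>" by simp
qed (use assms in auto)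

text \<open>Existence comes from the orthogonal decomposition along the subspace
  \<open>Lam2_20\<close>. The second claim lets \<open>pr_m\<close> disappear in pairings with
  elements of m.\<close>

lemma pr_m_in [simp]: "pr_m \<omega> \<in> Lam2_20"
  and inner_pr_m: "\<zeta> \<in> Lam2_20 \<Longrightarrow> inner (pr_m \<omega>) \<zeta> = inner \<omega> \<zeta>"
proof -
  obtain \<eta> z where "\<eta> \<in> span Lam2_20" and z: "\<And>w. w \<in> span Lam2_20 \<Longrightarrow> orthogonal z w" and \<omega>: "\<omega> = \<eta> + z"
    using orthogonal_subspace_decomp_exists [of Lam2_20 \<omega>] by blast
  then have \<eta>: "\<eta> \<in> Lam2_20"
    using subspace_Lam2_20 by (simp add: span_eq_iff [THEN iffD2])
  have orth: "inner (\<omega> - \<eta>) \<zeta> = 0" if "\<zeta> \<in> Lam2_20" for \<zeta>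
    using z [OF span_base [OF that]] by (simp add: \<omega> orthogonal_def)
  have "pr_m \<omega> = \<eta>" using \<eta> orth by (rule pr_m_unique)
  then show "pr_m \<omega> \<in> Lam2_20" "\<zeta> \<in> Lam2_20 \<Longrightarrow> inner (pr_m \<omega>) \<zeta> = inner \<omega> \<zeta>"
    using \<eta> orth by (simp_all add: inner_diff_left)
qed

lemma contract_rho0_Lam: "contract i rho0 \<in> Lam 2"
  using rho0_Lam contract_Lam [of rho0 2] by (simp add: eval_nat_numeral)

text \<open>By adjointness the pairing is a top coefficient of a wedge product containing the factor
  \<open>\<zeta> \<and>\<^sub>w hodge rho0\<close>, which vanishes by the definition of
  \<open>Lam2_20\<close>.\<close>

lemma inner_contract_rho0_Lam2_20:
  assumes "\<zeta> \<in> Lam2_20"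
  shows "inner (contract c rho0) \<zeta> = 0"
proof -
  have "inner (contract c rho0) \<zeta> = ((axis {c} 1 \<and>\<^sub>w \<zeta>) \<and>\<^sub>w hodge rho0) $ UNIV"
    by (simp only: inner_contract wedge_hodge_top) (rule inner_commute)
  also have "\<dots> = 0"
    using assms by (simp add: wedge_assoc Lam2_20_def)
  finally show ?thesis .
qed

text \<open>Against an m-valued tensor the projection drops out, and each contraction passes to its
  adjoint wedge product; \<open>inner_sigma2\<close> serves \<open>Theta2\<close> in the same
  way.\<close>

lemma inner_Theta1:
  assumes "G \<in> R8_m"
  shows "inner (Theta1 T) G = - (1/2) * inner T (Phi1 G)"
  using assms by (simp add: inner_vec_def [where 'a = form] Theta1_def R8_m_def inner_pr_m
      inner_contract Phi1_def inner_sum_right sum_distrib_left)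

lemma inner_Theta2:
  assumes "G \<in> R8_m"
  shows "inner (Theta2 F) G = - inner F (Phi2 G)"
  using assms by (simp add: inner_vec_def [where 'a = form] Theta2_def R8_m_def inner_pr_m
      inner_sigma2 contract_rho0_Lam Phi2_def inner_sum_right sum_negf)

text \<open>The degree-2 part of \<open>\<omega>\<close> is a combination of the contractions of
  \<open>rho0\<close>, and these are orthogonal to \<open>Lam2_20\<close>.\<close>

lemma inner_Lam2_20_eq_0:
  assumes "\<And>i j. form_comp \<omega> [i, j] = (\<Sum>c\<in>UNIV. \<mu> c * struct_const c i j)"
  shows "\<zeta> \<in> Lam2_20 \<Longrightarrow> inner \<omega> \<zeta> = 0"
proof -
  assume \<zeta>: "\<zeta> \<in> Lam2_20"
  define \<omega>' where "\<omega>' = (\<Sum>c\<in>UNIV. \<mu> c *\<^sub>R contract c rho0)"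
  have "form_comp \<omega>' [i, j] = form_comp \<omega> [i, j]" for i j
    by (simp add: \<omega>'_def linear_sum [OF linear_form_comp] linear_scale [OF linear_form_comp]
        assms struct_const_def form_comp_Cons [symmetric])
  \<comment> \<open>Coefficients of other degrees are unconstrained, but \<open>\<zeta>\<close> has
    degree 2 and pairs to zero with them.\<close>
  then have eq: "\<omega>' $ I = \<omega> $ I" if "card I = 2" for I
    using card_2_less_cases [OF that] form_comp_2 by metis
  have "inner \<omega> \<zeta> = inner \<omega>' \<zeta>"
    unfolding inner_vec_def
  proof (rule sum.cong)
    fix I :: "8 set"
    show "inner (\<omega> $ I) (\<zeta> $ I) = inner (\<omega>' $ I) (\<zeta> $ I)"
      using eq [of I] \<zeta> by (cases "card I = 2") (auto simp: Lam2_20_def Lam_def)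
  qed simp
  also have "\<dots> = 0"
    using \<zeta> by (simp add: \<omega>'_def inner_sum_left inner_contract_rho0_Lam2_20)
  finally show "inner \<omega> \<zeta> = 0" .
qed

text \<open>Each component of the sum is minus the m-part of a 2-form orthogonal to m, so its norm
  is zero.\<close>

lemma Theta_sum_eq_0:
  assumes "\<And>k i j. form_comp ((1/2) *\<^sub>R contract k T + sigma 2 (contract k rho0) F) [i, j]
      = (\<Sum>c\<in>UNIV. \<mu> k c * struct_const c i j)"
  shows "Theta1 T + Theta2 F = 0"
proof -
  have "(1/2) *\<^sub>R pr_m (contract k T) + pr_m (sigma 2 (contract k rho0) F) = 0" (is "?v = 0") for k
  proof -
    have v: "?v \<in> Lam2_20"
      using subspace_Lam2_20 by (simp add: subspace_add subspace_scale)
    have "inner ?v ?v = inner ((1/2) *\<^sub>R contract k T + sigma 2 (contract k rho0) F) ?v"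
      using v by (simp add: inner_add_left inner_pr_m)
    also have "\<dots> = 0"
      by (rule inner_Lam2_20_eq_0 [OF _ v]) (rule assms)
    finally show ?thesis by simp
  qed
  then show ?thesis
    by (simp add: vec_eq_iff [where 'a = form] Theta1_def Theta2_def neg_eq_iff_add_eq_0 add_eq_0_iff)
qed

text \<open>The first five components add up to zero, which leaves \<open>G 6\<close>. The type
  condition writes the same element as a sum of values of \<open>Theta1\<close> and
  \<open>Theta2\<close>, which are orthogonal to the common kernel of \<open>Phi1\<close> and
  \<open>Phi2\<close>; hence it is orthogonal to itself.\<close>

lemma W_components_eq_0:
  assumes G: "W_components \<Gamma> G" and type: "in_W_sum {1..5} \<Gamma>"
    and "Theta1 T = G 1 + G 2 + G 3" "Theta2 F = G 4 + G 5" "Theta1 T + Theta2 F = 0"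
  shows "\<Gamma> = 0"
proof -
  have "{1..6} = {1, 2, 3, 4, 5, 6 :: nat}" by auto
  with assms have \<Gamma>: "\<Gamma> = G 6" by (simp add: W_components_def ac_simps)
  have "G 6 \<in> W 6" using G by (simp add: W_components_def)
  then have 6: "G 6 \<in> R8_m" "Phi1 (G 6) = 0" "Phi2 (G 6) = 0" by (simp_all add: W_def)
  obtain H where H: "\<And>j. j \<in> {1..5} \<Longrightarrow> H j \<in> W j" "\<Gamma> = (\<Sum>j\<in>{1..5}. H j)"
    using type unfolding in_W_sum_def by blast
  have "inner (H j) (G 6) = 0" if j: "j \<in> {1..5}" for j
  proof -
    have "(\<exists>T. H j = Theta1 T) \<or> (\<exists>F. H j = Theta2 F)"
      using H(1) [OF j] j unfolding W_def by (auto split: if_splits)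
    then show ?thesis by (auto simp: inner_Theta1 inner_Theta2 6)
  qed
  then have "inner \<Gamma> (G 6) = 0" by (simp add: H(2) inner_sum_left)
  then show ?thesis by (simp add: \<Gamma>)
qed

section \<open>Tensors in frames\<close>

text \<open>Distributivity, with the choices encoded as index lists, the shape in which
  \<open>teval\<close> sums.\<close>

lemma prod_sum_lists:
  fixes f :: "nat \<Rightarrow> 'i::finite \<Rightarrow> real"
  shows "(\<Prod>r<n. \<Sum>i\<in>UNIV. f r i) = (\<Sum>is | length is = n. \<Prod>r<n. f r (is ! r))"
proof (induction n arbitrary: f)
  case (Suc n)
  have "(\<Sum>is | length is = Suc n. \<Prod>r<Suc n. f r (is ! r))
      = (\<Sum>(i, is)\<in>UNIV \<times> {is. length is = n}. f 0 i * (\<Prod>r<n. f (Suc r) (is ! r)))"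
    by (rule sum.reindex_bij_witness [where i = "\<lambda>(i, is). i # is" and j = "\<lambda>is. (hd is, tl is)"])
      (auto simp: length_Suc_conv prod.lessThan_Suc_shift simp del: prod.lessThan_Suc)
  also have "\<dots> = (\<Sum>i\<in>UNIV. f 0 i) * (\<Prod>r<n. \<Sum>i\<in>UNIV. f (Suc r) i)"
    by (simp add: Suc.IH sum_product sum.cartesian_product)
  finally show ?case by (simp add: prod.lessThan_Suc_shift del: prod.lessThan_Suc)
qed simp

text \<open>This is the pullback of a tensor by \<open>U\<close>: expand the matrix products and
  exchange the two sums. Changes of frame and changes of chart both go through it.\<close>

lemma teval_matrix:
  "teval t (map ((*v) U) vs) = teval (\<lambda>is. teval t (map (\<lambda>i. column i U) is)) vs"
proof -
  let ?n = "length vs"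
  have "teval t (map ((*v) U) vs)
      = (\<Sum>js | length js = ?n. t js * (\<Prod>r<?n. \<Sum>i\<in>UNIV. U $ (js ! r) $ i * (vs ! r) $ i))"
    by (simp add: teval_def matrix_vector_mult_def)
  also have "\<dots> = (\<Sum>js | length js = ?n. \<Sum>is | length is = ?n.
      t js * (\<Prod>r<?n. U $ (js ! r) $ (is ! r)) * (\<Prod>r<?n. (vs ! r) $ (is ! r)))"
    by (simp add: prod_sum_lists sum_distrib_left prod.distrib mult.assoc)
  also have "\<dots> = (\<Sum>is | length is = ?n. (\<Sum>js | length js = ?n.
      t js * (\<Prod>r<?n. U $ (js ! r) $ (is ! r))) * (\<Prod>r<?n. (vs ! r) $ (is ! r)))"
    by (subst sum.swap) (simp add: sum_distrib_right)
  also have "\<dots> = teval (\<lambda>is. teval t (map (\<lambda>i. column i U) is)) vs"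
    unfolding teval_def by (intro sum.cong refl) (auto simp: column_def)
  finally show ?thesis .
qed

lemma teval_cong:
  "(\<And>is. length is = length vs \<Longrightarrow> s is = t is) \<Longrightarrow> teval s vs = teval t vs"
  by (simp add: teval_def)

lemma column_eq_mult_axis: "column i (U :: real^'n^'m) = U *v axis i 1"
  by (simp add: matrix_vector_mult_basis)

lemma column_matrix_mult: "column i ((J :: real^'n^'m) ** U) = J *v column i U"
  by (simp add: column_eq_mult_axis matrix_vector_mul_assoc)

lemma matrix_inv_mult:
  fixes u :: "real^'n^'n"
  assumes "det u \<noteq> 0"
  shows "u ** matrix_inv u = mat 1" "matrix_inv u ** u = mat 1"
proof -
  have "\<exists>v. u ** v = mat 1 \<and> v ** u = mat 1"
    using assms invertible_det_nz [of u] by (simp add: invertible_def)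
  then have "u ** matrix_inv u = mat 1 \<and> matrix_inv u ** u = mat 1"
    unfolding matrix_inv_def by (rule someI_ex)
  then show "u ** matrix_inv u = mat 1" "matrix_inv u ** u = mat 1" by simp_all
qed

text \<open>The columns of \<open>u\<close> form a basis, so trilinear expressions that agree on
  them agree everywhere.\<close>

lemma teval_3_frame_cong:
  assumes "det u \<noteq> 0"
    and "\<And>i j k. teval s [column i u, column j u, column k u] = teval t [J *v column i u, J *v column j u, J *v column k u]"
  shows "teval s [x, y, z] = teval t [J *v x, J *v y, J *v z]"
proof -
  have u: "u *v (matrix_inv u *v v) = v" for v
    by (simp add: matrix_vector_mul_assoc matrix_inv_mult assms(1))
  \<comment> \<open>The coordinates of the three vectors in the frame \<open>u\<close>.\<close>
  define vs where "vs = map ((*v) (matrix_inv u)) [x, y, z]"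
  have "teval (\<lambda>is. teval s (map (\<lambda>i. column i u) is)) vs
      = teval (\<lambda>is. teval t (map (\<lambda>i. column i (J ** u)) is)) vs"
    by (rule teval_cong) (auto simp: vs_def length_Suc_conv eval_nat_numeral assms(2) column_matrix_mult)
  then have "teval s (map ((*v) u) vs) = teval t (map ((*v) (J ** u)) vs)"
    by (simp only: teval_matrix)
  then show ?thesis by (simp add: vs_def u matrix_vector_mul_assoc [symmetric])
qed

text \<open>Both sides alternate in the indices, and for increasing ones the equation is the
  definition of \<open>frame_form\<close>.\<close>

lemma form_comp_frame_form:
  assumes "\<And>a b c. t [b, a, c] = - t [a, b, c]" "\<And>a b c. t [a, c, b] = - t [a, b, c]"
  shows "form_comp (frame_form 3 t u) [i, j, k] = teval t [column i u, column j u, column k u]"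
proof (rule alternating3_eqI [where t = "\<lambda>i j k. teval t [column i u, column j u, column k u]"])
  show "alternating3 (\<lambda>i j k. form_comp (frame_form 3 t u) [i, j, k])"
    by (rule alternating3_form_comp)
  have 1: "teval t [x, y, z] = - teval t [y, x, z]" for x y z
  proof -
    have "teval t [x, y, z] = (\<Sum>j\<in>UNIV. \<Sum>i\<in>UNIV. \<Sum>k\<in>UNIV. t [i, j, k] * (x $ i * y $ j * z $ k))"
      unfolding teval_3 by (rule sum.swap)
    also have "\<dots> = - teval t [y, x, z]"
      unfolding teval_3 sum_negf [symmetric]
      by (intro sum.cong refl) (subst assms(1), simp add: ac_simps)
    finally show ?thesis .
  qed
  have 2: "teval t [x, y, z] = - teval t [x, z, y]" for x y z
  proof -
    have "teval t [x, y, z] = (\<Sum>i\<in>UNIV. \<Sum>k\<in>UNIV. \<Sum>j\<in>UNIV. t [i, j, k] * (x $ i * y $ j * z $ k))"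
      unfolding teval_3 by (rule sum.cong [OF refl sum.swap])
    also have "\<dots> = - teval t [x, z, y]"
      unfolding teval_3 sum_negf [symmetric]
      by (intro sum.cong refl) (subst assms(2), simp add: ac_simps)
    finally show ?thesis .
  qed
  show "alternating3 (\<lambda>i j k. teval t [column i u, column j u, column k u])"
    unfolding alternating3_def by (intro allI conjI 1 2)
next
  fix i j k :: 8 assume ijk: "i < j" "j < k"
  have "sorted_list_of_set (set [i, j, k]) = [i, j, k]"
    by (rule sorted_list_of_set.idem_if_sorted_distinct) (use ijk in auto)
  moreover have "i \<noteq> j" "i \<noteq> k" "j \<noteq> k" using ijk by auto
  then have "card {i, j, k} = 3" by simp
  ultimately show "form_comp (frame_form 3 t u) [i, j, k] = teval t [column i u, column j u, column k u]"
    using ijk by (simp add: form_comp_3 frame_form_def del: sorted_list_of_set_insert_remove)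
qed

section \<open>Connection terms and changes of chart\<close>

lemma conn_term_eq_matrix: "conn_term C c x X Y = (\<chi> l i. \<Sum>m\<in>UNIV. X $ m * C c x m i $ l) *v Y"
proof -
  have "(\<Sum>m\<in>UNIV. \<Sum>i\<in>UNIV. X $ m * Y $ i * C c x m i $ l)
      = (\<Sum>i\<in>UNIV. (\<Sum>m\<in>UNIV. X $ m * C c x m i $ l) * Y $ i)" for l
    by (subst sum.swap) (simp add: sum_distrib_left sum_distrib_right ac_simps)
  then show ?thesis by (simp add: vec_eq_iff conn_term_def matrix_vector_mult_def sum_component)
qed

text \<open>\<open>torsion\<close> is given on coordinate vectors; bilinearity of
  \<open>conn_term\<close> and of the metric extends the formula to all vectors.\<close>

lemma teval_torsion:
  "teval (torsion g C c x) [X, Y, Z] = teval (g c x) [conn_term C c x X Y - conn_term C c x Y X, Z]"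
proof -
  note lin = linear_sum [OF linear_teval_2(1)] linear_diff [OF linear_teval_2(1)] linear_scale [OF linear_teval_2(1)]
  have Z: "teval (g c x) [v, Z] = (\<Sum>l\<in>UNIV. Z $ l * teval (g c x) [v, axis l 1])" for v
    by (subst vec_eq_sum_axis [of Z])
      (simp add: linear_sum [OF linear_teval_2(2)] linear_scale [OF linear_teval_2(2)])
  have conn: "conn_term C c x Y X = (\<Sum>i\<in>UNIV. \<Sum>j\<in>UNIV. (X $ i * Y $ j) *\<^sub>R C c x j i)"
    unfolding conn_term_def by (subst sum.swap) (simp add: mult.commute)
  have "teval (g c x) [conn_term C c x X Y - conn_term C c x Y X, Z]
      = (\<Sum>i\<in>UNIV. \<Sum>j\<in>UNIV. (X $ i * Y $ j) * teval (g c x) [C c x i j - C c x j i, Z])"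
    by (simp add: conn conn_term_def [of C c x X Y] lin sum_subtractf right_diff_distrib)
  also have "\<dots> = teval (torsion g C c x) [X, Y, Z]"
    unfolding Z [of "C c x _ _ - _"] by (simp add: teval_3 torsion_def sum_distrib_left ac_simps)
  finally show ?thesis ..
qed

lemma chart_point:
  assumes "oriented_atlas A" "c \<in> A" "d \<in> A" "p \<in> chart_dom c" "p \<in> chart_dom d"
  shows "chart_map c p \<in> overlap c d" "transition c d (chart_map c p) = chart_map d p"
    "det (transition_jac c d (chart_map c p)) > 0"
proof -
  have "inj_on (chart_map c) (chart_dom c)"
    using assms(1,2) by (intro inj_on_inverseI [where g = "inv_into (chart_dom c) (chart_map c)"])
      (auto simp: oriented_atlas_def homeomorphism_def)
  then show "transition c d (chart_map c p) = chart_map d p"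
    using assms(4) by (simp add: transition_def)
  show "chart_map c p \<in> overlap c d" using assms by (auto simp: overlap_def)
  then show "det (transition_jac c d (chart_map c p)) > 0"
    using assms by (auto simp: oriented_atlas_def)
qed

lemma tensor_field_transform:
  assumes "tensor_field A k \<tau>" "c \<in> A" "d \<in> A" "x \<in> overlap c d" "length vs = k"
  shows "teval (\<tau> c x) vs = teval (\<tau> d (transition c d x)) (map ((*v) (transition_jac c d x)) vs)"
  unfolding teval_matrix
  by (rule teval_cong) (use assms in \<open>simp add: tensor_field_def\<close>)

lemma frame_form_transform:
  assumes "tensor_field A k \<tau>" "c \<in> A" "d \<in> A" "x \<in> overlap c d"
  shows "frame_form k (\<tau> d (transition c d x)) (transition_jac c d x ** u) = frame_form k (\<tau> c x) u"
  by (auto simp: vec_eq_iff frame_form_def tensor_field_transform [OF assms] column_matrix_mult o_def)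

lemma differential_form_3_swap:
  assumes "differential_form A 3 \<tau>" "c \<in> A" "x \<in> chart_img c"
  shows "\<tau> c x [b, a, d] = - \<tau> c x [a, b, d]" "\<tau> c x [a, d, b] = - \<tau> c x [a, b, d]"
proof -
  have swap: "\<tau> c x (is[r := is ! s, s := is ! r]) = - \<tau> c x is" if "length is = 3" "r < s" "s < 3" for "is" r s
    using assms that unfolding differential_form_def by blast
  show "\<tau> c x [b, a, d] = - \<tau> c x [a, b, d]" using swap [of "[a, b, d]" 0 1] by simp
  show "\<tau> c x [a, d, b] = - \<tau> c x [a, b, d]" using swap [of "[a, b, d]" 1 2] by (simp add: eval_nat_numeral)
qed

lemma levi_civita_symmetric:
  assumes "riemannian_metric A g" "c \<in> A" "open (chart_img c)" "x \<in> chart_img c"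
  shows "levi_civita g c x m i = levi_civita g c x i m"
proof -
  have "smooth_on (chart_img c) (\<lambda>y. g c y [m, i])"
    using assms(1,2) by (auto simp: riemannian_metric_def tensor_field_def)
  then have "Ck_on (Suc 0) (chart_img c) (\<lambda>y. g c y [m, i])"
    unfolding smooth_on_def by blast
  then have smooth: "(\<lambda>y. g c y [m, i]) differentiable (at x)"
    using assms(4) by simp
  \<comment> \<open>The symmetry of \<open>g\<close> is known on the chart image, whose openness
    passes it on to the derivatives.\<close>
  have "g c y [m, i] = g c y [i, m]" if "y \<in> chart_img c" for y
    using assms that by (auto simp: riemannian_metric_def)
  then have "frechet_derivative (\<lambda>y. g c y [m, i]) (at x) = frechet_derivative (\<lambda>y. g c y [i, m]) (at x)"
    using smooth assms(3,4) by (intro frechet_derivative_transform_within_open) auto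
  then show ?thesis by (simp add: levi_civita_def partial_def add.commute)
qed

section \<open>Parallel characteristic torsion\<close>

lemma trilinear_expand:
  fixes f :: "real^8 \<Rightarrow> real^8 \<Rightarrow> real^8 \<Rightarrow> real"
  assumes "\<And>y z. linear (\<lambda>x. f x y z)" "\<And>x z. linear (\<lambda>y. f x y z)" "\<And>x y. linear (\<lambda>z. f x y z)"
  shows "teval (\<lambda>is. f (axis (is ! 0) 1) (axis (is ! 1) 1) (axis (is ! 2) 1)) [x, y, z] = f x y z"
proof -
  have 1: "f x y z = (\<Sum>i\<in>UNIV. x $ i * f (axis i 1) y z)" for x y z
    by (subst vec_eq_sum_axis [of x]) (simp add: linear_sum [OF assms(1)] linear_scale [OF assms(1)])
  have 2: "f x y z = (\<Sum>i\<in>UNIV. y $ i * f x (axis i 1) z)" for x y z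
    by (subst vec_eq_sum_axis [of y]) (simp add: linear_sum [OF assms(2)] linear_scale [OF assms(2)])
  have 3: "f x y z = (\<Sum>i\<in>UNIV. z $ i * f x y (axis i 1))" for x y z
    by (subst vec_eq_sum_axis [of z]) (simp add: linear_sum [OF assms(3)] linear_scale [OF assms(3)])
  show ?thesis
    by (subst 1, subst 2, subst 3) (simp add: teval_3 sum_distrib_left ac_simps)
qed

locale parallel_torsion_structure =
  fixes A :: "'a::{t2_space,second_countable_topology} chart set"
    and g \<rho> T F :: "'a tensor"
    and C :: "'a connection"
  assumes psu3_structure: "psu3_structure A g \<rho>"
    and forms: "characteristic_forms A g \<rho> T F"
    and conn: "characteristic_connection A g \<rho> T F C"
    and parallel: "parallel_tensor A C 3 (torsion g C)"
begin

lemma atlas: "oriented_atlas A"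
  and metric: "riemannian_metric A g"
  and rho_form: "differential_form A 3 \<rho>"
  using psu3_structure by (simp_all add: psu3_structure_def)

lemma T_form: "differential_form A 3 T"
  and F_form: "differential_form A 4 F"
  using forms by (simp_all add: characteristic_forms_def)

lemma open_chart: "c \<in> A \<Longrightarrow> open (chart_dom c)" "c \<in> A \<Longrightarrow> open (chart_img c)"
  using atlas by (auto simp: oriented_atlas_def)

lemma covered: "\<exists>c\<in>A. p \<in> chart_dom c"
  using atlas by (auto simp: oriented_atlas_def)

section \<open>The torsion in adapted frames and under changes of chart\<close>

definition difference_form :: "'a chart \<Rightarrow> real^8 \<Rightarrow> real^8^8 \<Rightarrow> 8 \<Rightarrow> form" where
  "difference_form c x u k =
     (1/2) *\<^sub>R contract k (frame_form 3 (T c x) u) + sigma 2 (contract k rho0) (frame_form 4 (F c x) u)"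

text \<open>The Levi-Civita term is symmetric in the two directions and cancels, so only the
  difference of the two connections remains.\<close>

lemma torsion_frame:
  assumes "c \<in> A" "x \<in> chart_img c" "adapted_frame g \<rho> c x u"
  shows "teval (torsion g C c x) [column k u, column i u, column j u]
    = form_comp (difference_form c x u k) [i, j] - form_comp (difference_form c x u i) [k, j]"
proof -
  define t where "t k i j = teval (T c x) [column k u, column i u, column j u]" for k i j
  have t: "form_comp (contract k (frame_form 3 (T c x) u)) [i, j] = t k i j" for k i j
    unfolding form_comp_Cons [symmetric] t_def
    by (rule form_comp_frame_form) (rule differential_form_3_swap [OF T_form assms(1,2)])+
  have *: "teval (g c x) [conn_term C c x (column k u) (column i u), column j u]
      = teval (g c x) [conn_term (levi_civita g) c x (column k u) (column i u), column j u]
        + form_comp (difference_form c x u k) [i, j]" for k i j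
    using conn assms unfolding characteristic_connection_def
    by (simp add: difference_form_def linear_add [OF linear_form_comp] linear_scale [OF linear_form_comp] t t_def)
  have "conn_term (levi_civita g) c x X Y = conn_term (levi_civita g) c x Y X" for X Y
    unfolding conn_term_def
    by (subst sum.swap, intro sum.cong refl)
      (subst levi_civita_symmetric [OF metric assms(1) open_chart(2) [OF assms(1)] assms(2)],
       simp only: mult.commute)
  then show ?thesis
    by (simp add: teval_torsion linear_diff [OF linear_teval_2(1)] *)
qed

lemma adapted_frame_transform:
  assumes "c \<in> A" "d \<in> A" "p \<in> chart_dom c" "p \<in> chart_dom d"
    and u: "adapted_frame g \<rho> c (chart_map c p) u"
  shows "adapted_frame g \<rho> d (chart_map d p) (transition_jac c d (chart_map c p) ** u)"
proof -
  note chart = chart_point [OF atlas assms(1-4)]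
  note transform = tensor_field_transform [OF _ assms(1,2) chart(1), unfolded chart(2)]
  have "tensor_field A 2 g" using metric by (simp add: riemannian_metric_def)
  moreover have "tensor_field A 3 \<rho>" using rho_form by (simp add: differential_form_def)
  ultimately show ?thesis
    using u chart(3) transform [of 2 g]
      frame_form_transform [OF _ assms(1,2) chart(1), unfolded chart(2), of 3 \<rho>]
    by (simp add: adapted_frame_def det_mul column_matrix_mult)
qed

text \<open>The connection is a family of coefficients per chart, so the tensor law for its torsion
  has to be derived: in an adapted frame the torsion is expressed through \<open>T\<close> and
  \<open>F\<close>, which are tensor fields.\<close>

lemma torsion_transform:
  assumes "c \<in> A" "d \<in> A" "p \<in> chart_dom c" "p \<in> chart_dom d"
  defines "J \<equiv> transition_jac c d (chart_map c p)"
  shows "teval (torsion g C c (chart_map c p)) [X, Y, Z] = teval (torsion g C d (chart_map d p)) [J *v X, J *v Y, J *v Z]"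
proof -
  note chart = chart_point [OF atlas assms(1-4)]
  have img: "chart_map c p \<in> chart_img c" "chart_map d p \<in> chart_img d"
    using assms by (auto simp: chart_img_def)
  obtain u where u: "adapted_frame g \<rho> c (chart_map c p) u"
    using psu3_structure assms(1) img(1) by (auto simp: psu3_structure_def)
  have "difference_form c (chart_map c p) u k = difference_form d (chart_map d p) (J ** u) k" for k
    using T_form F_form
      frame_form_transform [OF _ assms(1,2) chart(1), unfolded chart(2), of 3 T]
      frame_form_transform [OF _ assms(1,2) chart(1), unfolded chart(2), of 4 F]
    by (simp add: difference_form_def J_def differential_form_def)
  then have frame: "teval (torsion g C c (chart_map c p)) [column k u, column i u, column j u]
      = teval (torsion g C d (chart_map d p)) [J *v column k u, J *v column i u, J *v column j u]" for k i j
    using torsion_frame [OF assms(1) img(1) u]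
      torsion_frame [OF assms(2) img(2) adapted_frame_transform [OF assms(1-4) u]]
    by (simp add: J_def column_matrix_mult)
  have "det u \<noteq> 0"
    using u by (simp add: adapted_frame_def)
  then show ?thesis
    by (rule teval_3_frame_cong) (rule frame)
qed

section \<open>The torsion along curves and under holonomy\<close>

lemma torsion_has_real_derivative_along:
  assumes c: "c \<in> A" and \<gamma>: "C1_curve A \<gamma>" "\<gamma> t \<in> chart_dom c"
    and V: "parallel_along A C \<gamma> V1" "parallel_along A C \<gamma> V2" "parallel_along A C \<gamma> V3"
  shows "((\<lambda>t. teval (torsion g C c (chart_map c (\<gamma> t))) [V1 c t, V2 c t, V3 c t]) has_real_derivative 0) (at t)"
proof -
  define \<phi> where "\<phi> = chart_map c \<circ> \<gamma>"
  define v where "v = vector_derivative \<phi> (at t)"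
  define x where "x = \<phi> t"
  define \<tau> where "\<tau> = torsion g C c"
  \<comment> \<open>\<open>K\<close> is the connection matrix in the direction of the velocity:
    parallel fields satisfy V' = -KV.\<close>
  define K where "K = (\<chi> l i. \<Sum>m\<in>UNIV. v $ m * C c x m i $ l)"
  have x: "x \<in> chart_img c" using \<gamma>(2) by (auto simp: x_def \<phi>_def chart_img_def)
  have "\<phi> differentiable (at t)"
    using \<gamma> c unfolding C1_curve_def \<phi>_def
    by (auto simp: C1_differentiable_on_eq)
  then have v: "(\<phi> has_vector_derivative v) (at t)"
    by (simp add: v_def vector_derivative_works)
  have V': "(V c has_vector_derivative - (K *v V c t)) (at t)" if "parallel_along A C \<gamma> V" for V
  proof -
    have "(V c has_vector_derivative - conn_term C c (chart_map c (\<gamma> t))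
        (vector_derivative (chart_map c \<circ> \<gamma>) (at t)) (V c t)) (at t)"
      using that c \<gamma>(2) unfolding parallel_along_def by blast
    then show ?thesis
      by (simp only: conn_term_eq_matrix K_def v_def x_def \<phi>_def o_apply)
  qed
  \<comment> \<open>Parallelism forces the coefficients of the torsion to change along the curve by
    \<open>K\<close> inserted in each slot; this cancels the three terms produced by V' =
    -KV.\<close>
  define \<tau>' where "\<tau>' is = teval (\<tau> x) [K *v axis (is ! 0) 1, axis (is ! 1) 1, axis (is ! 2) 1]
    + teval (\<tau> x) [axis (is ! 0) 1, K *v axis (is ! 1) 1, axis (is ! 2) 1]
    + teval (\<tau> x) [axis (is ! 0) 1, axis (is ! 1) 1, K *v axis (is ! 2) 1]" for "is"
  have "((\<lambda>t. \<tau> (\<phi> t) [i, j, k]) has_real_derivative \<tau>' [i, j, k]) (at t)" for i j k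
  proof -
    let ?f = "\<lambda>y. \<tau> y [i, j, k]"
    let ?D = "frechet_derivative ?f (at x)"
    have f: "?f differentiable (at x)" and cov: "cov_deriv_tensor C (torsion g C) c x m [i, j, k] = 0" for m
      using parallel c x unfolding parallel_tensor_def \<tau>_def by simp_all
    have D: "(?f has_derivative ?D) (at x)"
      using f by (simp add: frechet_derivative_works)
    have "linear ?D" using has_derivative_linear [OF D] .
    have "((?f \<circ> \<phi>) has_derivative ?D \<circ> (\<lambda>s. s *\<^sub>R v)) (at t)"
      using v D unfolding has_vector_derivative_def x_def by (rule diff_chain_at)
    then have "((?f \<circ> \<phi>) has_vector_derivative ?D v) (at t)"
      by (simp add: has_vector_derivative_def o_def linear_scale [OF \<open>linear ?D\<close>])
    moreover have "?D v = \<tau>' [i, j, k]"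
    proof -
      have partial: "partial m ?f x = (\<Sum>l\<in>UNIV. C c x m i $ l * \<tau> x [l, j, k])
          + (\<Sum>l\<in>UNIV. C c x m j $ l * \<tau> x [i, l, k]) + (\<Sum>l\<in>UNIV. C c x m k $ l * \<tau> x [i, j, l])" for m
        using cov [of m] by (simp add: cov_deriv_tensor_def \<tau>_def eval_nat_numeral lessThan_Suc)
      have K: "K *v axis i 1 = (\<Sum>m\<in>UNIV. v $ m *\<^sub>R C c x m i)" for i
        by (simp add: column_eq_mult_axis [symmetric] vec_eq_iff column_def K_def sum_component)
      have w: "w = (\<Sum>l\<in>UNIV. w $ l *\<^sub>R axis l 1)" for w :: "real^8" by (rule vec_eq_sum_axis)
      have e: "teval (\<tau> x) [w, axis j 1, axis k 1] = (\<Sum>l\<in>UNIV. w $ l * \<tau> x [l, j, k])"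
        "teval (\<tau> x) [axis i 1, w, axis k 1] = (\<Sum>l\<in>UNIV. w $ l * \<tau> x [i, l, k])"
        "teval (\<tau> x) [axis i 1, axis j 1, w] = (\<Sum>l\<in>UNIV. w $ l * \<tau> x [i, j, l])" for w
        by (subst w, simp add: linear_sum [OF linear_teval_3(1)] linear_scale [OF linear_teval_3(1)] teval_3_axis,
            subst w, simp add: linear_sum [OF linear_teval_3(2)] linear_scale [OF linear_teval_3(2)] teval_3_axis,
            subst w, simp add: linear_sum [OF linear_teval_3(3)] linear_scale [OF linear_teval_3(3)] teval_3_axis)
      have "?D v = (\<Sum>m\<in>UNIV. v $ m * partial m ?f x)"
        by (subst w [of v]) (simp add: linear_sum [OF \<open>linear ?D\<close>] linear_scale [OF \<open>linear ?D\<close>] partial_def)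
      also have "\<dots> = \<tau>' [i, j, k]"
        by (simp add: \<tau>'_def K linear_sum [OF linear_teval_3(1)] linear_scale [OF linear_teval_3(1)]
            linear_sum [OF linear_teval_3(2)] linear_scale [OF linear_teval_3(2)]
            linear_sum [OF linear_teval_3(3)] linear_scale [OF linear_teval_3(3)] e partial
            distrib_left sum.distrib)
      finally show ?thesis .
    qed
    ultimately show ?thesis
      by (simp add: o_def has_real_derivative_iff_has_vector_derivative)
  qed
  from teval_3_has_real_derivative [of "\<lambda>t. \<tau> (\<phi> t)" \<tau>', OF this V' V' V', OF V]
  have "((\<lambda>t. teval (\<tau> (\<phi> t)) [V1 c t, V2 c t, V3 c t]) has_real_derivative
      teval \<tau>' [V1 c t, V2 c t, V3 c t] + teval (\<tau> x) [- (K *v V1 c t), V2 c t, V3 c t]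
      + teval (\<tau> x) [V1 c t, - (K *v V2 c t), V3 c t] + teval (\<tau> x) [V1 c t, V2 c t, - (K *v V3 c t)]) (at t)"
    by (simp add: x_def)
  moreover have "teval \<tau>' [X, Y, Z] = teval (\<tau> x) [K *v X, Y, Z] + teval (\<tau> x) [X, K *v Y, Z] + teval (\<tau> x) [X, Y, K *v Z]"
    for X Y Z
  proof -
    have K: "linear ((*v) K)" by simp
    show ?thesis
      unfolding \<tau>'_def [abs_def]
      by (rule trilinear_expand [of "\<lambda>X Y Z. teval (\<tau> x) [K *v X, Y, Z] + teval (\<tau> x) [X, K *v Y, Z] + teval (\<tau> x) [X, Y, K *v Z]"])
        (intro linear_compose_add linear_teval_3 linear_compose [OF K, unfolded o_def])+
  qed
  ultimately show ?thesis
    by (simp add: linear_neg [OF linear_teval_3(1)] linear_neg [OF linear_teval_3(2)] linear_neg [OF linear_teval_3(3)]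
        \<tau>_def \<phi>_def)
qed

text \<open>Between \<open>r\<close> and \<open>s\<close> the curve may leave the chart. All charts
  around the current point give the same value, so there is one function of time, and its derivative
  vanishes everywhere.\<close>

lemma torsion_constant_along:
  assumes c: "c \<in> A" and \<gamma>: "C1_curve A \<gamma>" "\<gamma> r \<in> chart_dom c" "\<gamma> s \<in> chart_dom c"
    and V: "parallel_along A C \<gamma> V1" "parallel_along A C \<gamma> V2" "parallel_along A C \<gamma> V3"
  shows "teval (torsion g C c (chart_map c (\<gamma> r))) [V1 c r, V2 c r, V3 c r]
    = teval (torsion g C c (chart_map c (\<gamma> s))) [V1 c s, V2 c s, V3 c s]"
proof -
  define f where "f c t = teval (torsion g C c (chart_map c (\<gamma> t))) [V1 c t, V2 c t, V3 c t]" for c t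
  define ch where "ch t = (SOME c. c \<in> A \<and> \<gamma> t \<in> chart_dom c)" for t
  have ch: "ch t \<in> A \<and> \<gamma> t \<in> chart_dom (ch t)" for t
  proof -
    have "\<exists>c. c \<in> A \<and> \<gamma> t \<in> chart_dom c" using covered by blast
    then show ?thesis unfolding ch_def by (rule someI_ex)
  qed
  have f_eq: "f c t = f d t" if "c \<in> A" "d \<in> A" "\<gamma> t \<in> chart_dom c" "\<gamma> t \<in> chart_dom d" for c d t
  proof -
    have "V d t = transition_jac c d (chart_map c (\<gamma> t)) *v V c t" if "parallel_along A C \<gamma> V" for V
      using that \<open>c \<in> A\<close> \<open>d \<in> A\<close> \<open>\<gamma> t \<in> chart_dom c\<close> \<open>\<gamma> t \<in> chart_dom d\<close> unfolding parallel_along_def by blast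
    then show ?thesis
      unfolding f_def using V by (simp add: torsion_transform [OF that])
  qed
  have "((\<lambda>t. f (ch t) t) has_real_derivative 0) (at t)" for t
  proof -
    \<comment> \<open>The chosen chart may jump near \<open>t\<close>; freezing it changes no value
      on the open set of times at which the curve lies in its domain.\<close>
    define d where "d = ch t"
    have d: "d \<in> A" "\<gamma> t \<in> chart_dom d" using ch by (simp_all add: d_def)
    have "(f d has_real_derivative 0) (at t)"
      using torsion_has_real_derivative_along [OF d(1) \<gamma>(1) d(2) V] by (simp add: f_def [abs_def])
    moreover have "open (\<gamma> -` chart_dom d)"
      using \<gamma>(1) open_chart(1) [OF d(1)] by (auto simp: C1_curve_def intro: open_vimage)
    ultimately show ?thesis
    proof (rule has_field_derivative_transform_within_open)
      show "t \<in> \<gamma> -` chart_dom d" using d by simp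
      show "f d s = f (ch s) s" if "s \<in> \<gamma> -` chart_dom d" for s
        using that d ch by (intro f_eq) auto
    qed
  qed
  then have "f (ch r) r = f (ch s) s"
    by (intro DERIV_isconst_all [where f = "\<lambda>t. f (ch t) t"]) blast
  then have "f c r = f c s"
    using f_eq [OF c _ \<gamma>(2), of "ch r"] f_eq [OF c _ \<gamma>(3), of "ch s"] ch by simp
  then show ?thesis by (simp add: f_def)
qed

text \<open>Parallel transport around the loop carries the three vectors to their images under
  \<open>P\<close>; compare the torsion at times 1 and 0.\<close>

lemma holonomy_preserves_torsion:
  assumes "c \<in> A" "p \<in> chart_dom c" "P \<in> holonomy_group A C c p"
  shows "teval (torsion g C c (chart_map c p)) [P *v X, P *v Y, P *v Z] = teval (torsion g C c (chart_map c p)) [X, Y, Z]"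
proof -
  obtain \<gamma> where \<gamma>: "C1_curve A \<gamma>" "\<gamma> 0 = p" "\<gamma> 1 = p"
    and "\<And>v. \<exists>V. parallel_along A C \<gamma> V \<and> V c 0 = v \<and> V c 1 = P *v v"
    using assms(3) unfolding holonomy_group_def by blast
  then obtain V where V: "\<And>v. parallel_along A C \<gamma> (V v)" "\<And>v. V v c 0 = v" "\<And>v. V v c 1 = P *v v"
    by metis
  show ?thesis
    using torsion_constant_along [OF assms(1) \<gamma>(1), of 1 0, OF _ _ V(1) V(1) V(1), of X Y Z] \<gamma> assms(2)
    by (simp add: V)
qed

text \<open>In the frame \<open>u\<close> the holonomy algebra contains the inner derivation by the
  basis vector of index \<open>a\<close>, whose entries are the
  \<open>struct_const a k l\<close>.\<close>

lemma torsion_frame_invariant: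
  assumes c: "c \<in> A" "p \<in> chart_dom c"
    and u: "adapted_frame g \<rho> c (chart_map c p) u"
    and hol: "psu3 \<subseteq> holonomy_algebra A C c p u"
  defines "\<tau> \<equiv> \<lambda>k i j. teval (torsion g C c (chart_map c p)) [column k u, column i u, column j u]"
  shows "(\<Sum>l\<in>UNIV. struct_const a k l * \<tau> l i j) + (\<Sum>l\<in>UNIV. struct_const a i l * \<tau> k l j) + (\<Sum>l\<in>UNIV. struct_const a j l * \<tau> k i l) = 0"
proof -
  let ?t = "torsion g C c (chart_map c p)"
  let ?D = "matrix (bracket (axis a 1))"
  have "?D \<in> holonomy_algebra A C c p u" using hol ad_in_psu3 by blast
  then obtain B where B: "B \<in> lie_algebra (holonomy_group A C c p)" "?D = matrix_inv u ** B ** u"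
    unfolding holonomy_algebra_def by blast
  have "det u \<noteq> 0" using u by (simp add: adapted_frame_def)
  \<comment> \<open>Undoing the conjugation by the frame shows that \<open>B\<close> acts on the
    frame vectors through the inner derivation.\<close>
  then have "u ** ?D = B ** u"
    by (simp add: B(2) matrix_mul_assoc matrix_inv_mult)
  then have "B *v column k u = u *v (?D *v axis k 1)" for k
    by (simp add: column_eq_mult_axis matrix_vector_mul_assoc)
  moreover have "?D *v axis k 1 = (\<Sum>l\<in>UNIV. struct_const a k l *\<^sub>R axis l 1)" for k
    using vec_eq_sum_axis [of "bracket (axis a 1) (axis k 1)"]
    by (simp add: matrix_works linear_bracket bracket_axis_axis_nth)
  ultimately have B': "B *v column k u = (\<Sum>l\<in>UNIV. struct_const a k l *\<^sub>R column l u)" for k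
    by (simp add: linear_sum [OF matrix_vector_mul_linear] linear_scale [OF matrix_vector_mul_linear] column_eq_mult_axis)
  have "teval ?t [B *v column k u, column i u, column j u] + teval ?t [column k u, B *v column i u, column j u]
      + teval ?t [column k u, column i u, B *v column j u] = 0"
    using B(1) holonomy_preserves_torsion [OF c] by (rule lie_algebra_annihilates)
  then show ?thesis
    unfolding B' \<tau>_def
    by (simp add: linear_sum [OF linear_teval_3(1)] linear_scale [OF linear_teval_3(1)]
        linear_sum [OF linear_teval_3(2)] linear_scale [OF linear_teval_3(2)]
        linear_sum [OF linear_teval_3(3)] linear_scale [OF linear_teval_3(3)])
qed

text \<open>The difference forms inherit the invariance of the torsion;
  \<open>invariant_in_span_struct_const\<close> then makes their components combinations of those of
  the contractions of \<open>rho0\<close>, which leaves no part in m.\<close>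

lemma Theta_sum_characteristic_forms_eq_0:
  assumes c: "c \<in> A" "p \<in> chart_dom c"
    and u: "adapted_frame g \<rho> c (chart_map c p) u"
    and hol: "psu3 \<subseteq> holonomy_algebra A C c p u"
  shows "Theta1 (frame_form 3 (T c (chart_map c p)) u) + Theta2 (frame_form 4 (F c (chart_map c p)) u) = 0"
proof -
  define \<tau> where "\<tau> k i j = teval (torsion g C c (chart_map c p)) [column k u, column i u, column j u]" for k i j
  define D where "D k i j = form_comp (difference_form c (chart_map c p) u k) [i, j]" for k i j
  have skew: "D k i j = - D k j i" for k i j
    unfolding D_def by (rule form_comp_swap)
  have "chart_map c p \<in> chart_img c" using c by (simp add: chart_img_def)
  then have "\<tau> k i j = D k i j - D i k j" for k i j
    unfolding \<tau>_def D_def using torsion_frame [OF c(1) _ u] by blast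
  \<comment> \<open>a metric connection is recovered from its torsion by the Koszul formula\<close>
  then have D: "D k i j = (\<tau> k i j - \<tau> i j k + \<tau> j k i) / 2" for k i j
    using skew [of i j k] skew [of j k i] skew [of k j i] by simp
  have inv: "(\<Sum>l\<in>UNIV. struct_const a k l * \<tau> l i j) + (\<Sum>l\<in>UNIV. struct_const a i l * \<tau> k l j) + (\<Sum>l\<in>UNIV. struct_const a j l * \<tau> k i l) = 0" for a k i j
    unfolding \<tau>_def by (rule torsion_frame_invariant [OF c u hol])
  have "(\<Sum>l\<in>UNIV. struct_const a k l * D l i j + struct_const a i l * D k l j + struct_const a j l * D k i l) = 0" for a k i j
  proof -
    \<comment> \<open>\<open>D\<close> combines three index permutations of \<open>\<tau>\<close>,
      so its invariance expression is the same combination of permuted invariance expressions of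
      \<open>\<tau>\<close>.\<close>
    have "(\<Sum>l\<in>UNIV. struct_const a k l * D l i j + struct_const a i l * D k l j + struct_const a j l * D k i l)
      = (((\<Sum>l\<in>UNIV. struct_const a k l * \<tau> l i j) + (\<Sum>l\<in>UNIV. struct_const a i l * \<tau> k l j) + (\<Sum>l\<in>UNIV. struct_const a j l * \<tau> k i l))
       - ((\<Sum>l\<in>UNIV. struct_const a i l * \<tau> l j k) + (\<Sum>l\<in>UNIV. struct_const a j l * \<tau> i l k) + (\<Sum>l\<in>UNIV. struct_const a k l * \<tau> i j l))
       + ((\<Sum>l\<in>UNIV. struct_const a j l * \<tau> l k i) + (\<Sum>l\<in>UNIV. struct_const a k l * \<tau> j l i) + (\<Sum>l\<in>UNIV. struct_const a i l * \<tau> j k l))) / 2"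
      unfolding D sum.distrib [symmetric] sum_subtractf [symmetric] sum_divide_distrib
      by (intro sum.cong refl) (simp add: field_simps)
    then show ?thesis by (simp add: inv)
  qed
  from invariant_in_span_struct_const [OF this skew]
  have "form_comp (difference_form c (chart_map c p) u k) [i, j]
    = (\<Sum>a\<in>UNIV. (\<Sum>l\<in>UNIV. \<Sum>m\<in>UNIV. struct_const a l m * D k l m) / 12 * struct_const a i j)" for k i j
    unfolding D_def [symmetric] by (simp add: sum_divide_distrib [where r = 12 and A = "UNIV :: 8 set", symmetric])
  then show ?thesis
    unfolding difference_form_def by (rule Theta_sum_eq_0)
qed

end

theorem proposition6p1:
  fixes A :: "'a::{t2_space,second_countable_topology} chart set"
    and g \<rho> T F :: "'a tensor"
    and C :: "'a connection"
  assumes "psu3_structure A g \<rho>"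
    and "of_type A g \<rho> {1..5}"
    and "characteristic_forms A g \<rho> T F"
    and "characteristic_connection A g \<rho> T F C"
    and "parallel_tensor A C 3 (torsion g C)"
    and "\<forall>c\<in>A. \<forall>p\<in>chart_dom c. \<forall>u. adapted_frame g \<rho> c (chart_map c p) u \<longrightarrow>
           holonomy_algebra A C c p u = psu3"
  shows "psu3_integrable A g \<rho>"
  unfolding psu3_integrable_def
proof (intro allI impI ballI)
  fix c U e x
  assume e: "local_adapted_frame A g \<rho> c U e" and x: "x \<in> U"
  interpret parallel_torsion_structure A g \<rho> T F C
    by unfold_locales (fact assms)+
  have c: "c \<in> A" and u: "adapted_frame g \<rho> c x (e x)" and "x \<in> chart_img c"
    using e x by (auto simp: local_adapted_frame_def)
  then obtain p where p: "p \<in> chart_dom c" "x = chart_map c p"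
    by (auto simp: chart_img_def)
  \<comment> \<open>The holonomy condition covers every adapted frame at every point, in particular
    the value of the frame field at \<open>x\<close>.\<close>
  have "psu3 \<subseteq> holonomy_algebra A C c p (e x)"
    using assms(6) c p u by blast
  then have 0: "Theta1 (frame_form 3 (T c x) (e x)) + Theta2 (frame_form 4 (F c x) (e x)) = 0"
    using Theta_sum_characteristic_forms_eq_0 [OF c p(1)] u unfolding p(2) by blast
  obtain G where G: "W_components (intrinsic_torsion g c e x) G"
    "Theta1 (frame_form 3 (T c x) (e x)) = G 1 + G 2 + G 3"
    "Theta2 (frame_form 4 (F c x) (e x)) = G 4 + G 5"
    using assms(3) e x unfolding characteristic_forms_def by blast
  have "in_W_sum {1..5} (intrinsic_torsion g c e x)"
    using assms(2) e x unfolding of_type_def by blast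
  then show "intrinsic_torsion g c e x = 0"
    using G 0 by (blast intro: W_components_eq_0)
qed

end
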